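(* Let $T\colon(0,1]\to[0,1)$, $T(x)=\frac1x-\left\lfloor\frac1x\right\rfloor$, be the Gauss map. As $n\to\infty$, the measure $$\left(\sum_{x\in{\rm Per}_n(T)}|(T^n)'x|^{-1}\right)^{-1}\sum_{x\in{\rm Per}_n(T)}|(T^n)'x|^{-1}\,\delta_x^n(T)$$ converges in the weak*-topology to the Gauss measure $\frac{1}{\log 2}\frac{dx}{1+x}$.
   Context: ${\rm Per}_n(T)=\{x\in(0,1)\setminus\mathbb Q: T^nx=x\}$. For $x\in(0,1)\setminus\mathbb Q$ and $n\ge1$, $\delta_x^n(T)$ is the uniform probability distribution on $\{x,Tx,\ldots,T^{n-1}x\}$, i.e. $\delta_x^n(T)=\frac1n\sum_{i=0}^{n-1}\delta_{T^ix}$. $(T^n)'x$ denotes the derivative of $T^n$ at $x$. Weak*-convergence is convergence of integrals of bounded continuous functions; the measures are regarded as Borel probability measures on $(0,1)\setminus\mathbb Q$ (equivalently on $[0,1]$, since all of them give full measure to the irrationals). *)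

theory Defs
  imports "HOL-Probability.Probability"
begin

definition irr01 :: "real set" where
  "irr01 = {0<..<1} - \<rat>"

text \<open>The Gauss map, as a total function on the reals; only its values on (0,1] matter.\<close>

definition gauss_map :: "real \<Rightarrow> real" where
  "gauss_map x = 1 / x - of_int \<lfloor>1 / x\<rfloor>"

definition Per :: "nat \<Rightarrow> real set" where
  "Per n = {x \<in> irr01. (gauss_map ^^ n) x = x}"

text \<open>The space of irrationals in (0,1) with its Borel sets; all measures below live on it.
  Only the underlying sigma-algebra of this measure is used.\<close>

definition borel_irr :: "real measure" where
  "borel_irr = restrict_space borel irr01"

text \<open>The average of the point masses at the points of the orbit segment of length n,
  obtained as the image of the uniform distribution on the index set.\<close>

definition orbit_measure :: "nat \<Rightarrow> real \<Rightarrow> real measure" where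
  "orbit_measure n x =
     distr (uniform_count_measure {..<n}) borel_irr (\<lambda>i. (gauss_map ^^ i) x)"

definition per_weight :: "nat \<Rightarrow> real \<Rightarrow> real" where
  "per_weight n x = inverse \<bar>deriv (gauss_map ^^ n) x\<bar>"

text \<open>The sum of the orbit measures weighted by a nonnegative function w on a (countable) set X is
  formed by the monadic bind of the measure on X with point masses w; the lemma
  emeasure_periodic_measure below gives it on sets. The (infinite) sums over the
  periodic points are integrals against the counting measure, in the extended nonnegative reals.\<close>

definition periodic_measure :: "nat \<Rightarrow> real measure" where
  "periodic_measure n =
     scale_measure (inverse (\<integral>\<^sup>+x. ennreal (per_weight n x) \<partial>count_space (Per n)))
       (density (count_space (Per n)) (\<lambda>x. ennreal (per_weight n x)) \<bind> orbit_measure n)"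

definition gauss_measure :: "real measure" where
  "gauss_measure =
     density (restrict_space lborel irr01) (\<lambda>x. ennreal (1 / (ln 2 * (1 + x))))"

text \<open>Weak-star convergence of finite Borel measures on a subspace X of the reals.\<close>

definition weak_star_converges :: "real set \<Rightarrow> (nat \<Rightarrow> real measure) \<Rightarrow> real measure \<Rightarrow> bool" where
  "weak_star_converges X M N \<longleftrightarrow>
     (\<forall>f :: real \<Rightarrow> real. continuous_on X f \<and> bounded (f ` X) \<longrightarrow>
        (\<lambda>n. \<integral>x. f x \<partial>M n) \<longlonglongrightarrow> (\<integral>x. f x \<partial>N))"

lemma irr01_borel [measurable]: "irr01 \<in> sets borel"
proof -
  have "(\<rat> :: real set) \<in> sets borel"
    by (rule sets.countable) (auto simp: countable_rat)
  then show ?thesis unfolding irr01_def by auto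
qed

lemma space_borel_irr [simp]: "space borel_irr = irr01"
  by (simp add: borel_irr_def space_restrict_space)

lemma gauss_map_irr01: "x \<in> irr01 \<Longrightarrow> gauss_map x \<in> irr01"
proof -
  assume x: "x \<in> irr01"
  have g: "gauss_map x \<notin> \<rat>"
  proof
    assume "gauss_map x \<in> \<rat>"
    then have "gauss_map x + of_int \<lfloor>1 / x\<rfloor> \<in> \<rat>" by simp
    then have "1 / x \<in> \<rat>" by (simp add: gauss_map_def)
    then have "inverse (1 / x) \<in> \<rat>" by (rule Rats_inverse)
    then show False using x by (simp add: irr01_def)
  qed
  moreover have "0 \<le> gauss_map x" "gauss_map x < 1"
    unfolding gauss_map_def by linarith+
  moreover have "gauss_map x \<noteq> 0" using g by auto
  ultimately show ?thesis by (simp add: irr01_def)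
qed

lemma gauss_iterate_irr01: "x \<in> irr01 \<Longrightarrow> (gauss_map ^^ i) x \<in> irr01"
  by (induction i) (auto intro: gauss_map_irr01)

lemma emeasure_orbit_measure:
  assumes "x \<in> irr01" "A \<in> sets borel_irr" "n \<ge> 1"
  shows "emeasure (orbit_measure n x) A =
    ennreal (1 / real n * (\<Sum>i<n. indicator A ((gauss_map ^^ i) x)))"
proof -
  have m: "(\<lambda>i. (gauss_map ^^ i) x) \<in> uniform_count_measure {..<n} \<rightarrow>\<^sub>M borel_irr"
    using gauss_iterate_irr01[OF assms(1)] by (auto simp: measurable_def space_uniform_count_measure sets_uniform_count_measure)
  have "emeasure (orbit_measure n x) A =
      emeasure (uniform_count_measure {..<n}) {i \<in> {..<n}. (gauss_map ^^ i) x \<in> A}"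
    unfolding orbit_measure_def using assms(2)
    by (subst emeasure_distr[OF m])
       (auto simp: space_uniform_count_measure intro!: arg_cong[where f = "emeasure _"])
  also have "\<dots> = ennreal (real (card {i \<in> {..<n}. (gauss_map ^^ i) x \<in> A}) / real n)"
    by (subst emeasure_uniform_count_measure) auto
  also have "real (card {i \<in> {..<n}. (gauss_map ^^ i) x \<in> A}) =
      (\<Sum>i<n. indicator A ((gauss_map ^^ i) x))"
    by (simp add: indicator_def sum.If_cases Int_def flip: sum.inter_filter)
  finally show ?thesis by simp
qed

lemma emeasure_periodic_measure:
  assumes "A \<in> sets borel_irr" "n \<ge> 1" "Per n \<noteq> {}"
  shows "emeasure (periodic_measure n) A =
    inverse (\<integral>\<^sup>+x. ennreal (per_weight n x) \<partial>count_space (Per n)) *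
    (\<integral>\<^sup>+x. ennreal (per_weight n x) * emeasure (orbit_measure n x) A \<partial>count_space (Per n))"
proof -
  have ps: "prob_space (orbit_measure n x)" if "x \<in> Per n" for x
    unfolding orbit_measure_def
  proof (rule prob_space.prob_space_distr)
    show "prob_space (uniform_count_measure {..<n})"
      using assms(2) by (intro prob_space_uniform_count_measure) (auto simp: lessThan_empty_iff)
    show "(\<lambda>i. (gauss_map ^^ i) x) \<in> uniform_count_measure {..<n} \<rightarrow>\<^sub>M borel_irr"
      using that gauss_iterate_irr01
      by (auto simp: measurable_def space_uniform_count_measure sets_uniform_count_measure Per_def)
  qed
  have k: "orbit_measure n \<in> density (count_space (Per n)) (\<lambda>x. ennreal (per_weight n x)) \<rightarrow>\<^sub>M
      subprob_algebra borel_irr"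
    using ps by (auto simp: measurable_def space_subprob_algebra orbit_measure_def
        intro: prob_space_imp_subprob_space)
  show ?thesis
    unfolding periodic_measure_def using assms(1,3)
    by (subst emeasure_scale_measure)
       (simp add: emeasure_bind[OF _ k] nn_integral_density)
qed

end

theory Submission
  imports Defs
begin

text \<open>The density of the Gauss measure turns the transfer operator of the Gauss map into a Markov
  operator \<open>U\<close> (\<open>gauss_op\<close>) that reverses monotonicity and halves the oscillation of monotone
  functions. Hence \<open>U\<^sup>n\<close> of the indicator of \<open>(-\<infinity>, t]\<close> is within \<open>2 ^ - n\<close> of the Gauss measure of
  that set. Now \<open>U\<^sup>n f (y)\<close> is a sum over words \<open>a\<close> of length \<open>n\<close> of \<open>p\<^sub>a(y) f (\<psi>\<^sub>a y)\<close>, where \<open>\<psi>\<^sub>a\<close> is the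
  corresponding inverse branch of the \<open>n\<close>-th iterate; the periodic points are the fixed points
  \<open>x\<^sub>a\<close> of the branches, and \<open>p\<^sub>a(x\<^sub>a)\<close> is exactly the weight of \<open>x\<^sub>a\<close>. On an interval of length \<open>d\<close>
  the values \<open>p\<^sub>a(x\<^sub>a)\<close> and \<open>p\<^sub>a(y)\<close> differ by a factor of about \<open>(1 + d)\<^sup>3\<close>, so cutting \<open>(0, t]\<close> into
  \<open>n\<close> pieces shows that the weights of the periodic points in \<open>(0, t]\<close> sum to the Gauss measure of
  \<open>(0, t]\<close> in the limit. The weights are constant along periodic orbits, so averaging over the
  orbits changes nothing, and convergence of the distribution functions yields weak convergence.
  As the test functions need only be continuous on the irrationals, this last step uses
  Skorohod's representation.\<close>

section \<open>Contraction of the Gauss-Kuzmin operator on monotone functions\<close>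

text \<open>With \<open>phi y = 1 / (real k + 1 + y)\<close> and \<open>h y = 1 / (1 + y)\<close>
  this is \<open>|phi' y| * h (phi y) / h y\<close>. Indices start at 0: \<open>k\<close> belongs to
  the continued fraction digit \<open>k + 1\<close>.\<close>

definition gauss_prob :: "nat \<Rightarrow> real \<Rightarrow> real" where
  "gauss_prob k y = (1 + y) / ((real k + 1 + y) * (real k + 2 + y))"

definition gauss_op :: "(real \<Rightarrow> real) \<Rightarrow> real \<Rightarrow> real" where
  "gauss_op f y = (\<Sum>k. gauss_prob k y * f (1 / (real k + 1 + y)))"

lemma gauss_prob_nonneg: "0 \<le> y \<Longrightarrow> 0 \<le> gauss_prob k y"
  by (simp add: gauss_prob_def)

text \<open>Partial fractions. The telescoping form yields both the total mass 1 and the tails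
  \<open>(1 + y) / (real m + 1 + y)\<close>.\<close>

lemma gauss_prob_diff:
  assumes "0 \<le> y"
  shows "gauss_prob k y = (1 + y) / (real k + 1 + y) - (1 + y) / (real (Suc k) + 1 + y)"
  using assms by (simp add: gauss_prob_def divide_simps) (simp add: algebra_simps)

lemma gauss_prob_sums:
  assumes "0 \<le> y"
  shows "(\<lambda>k. gauss_prob k y) sums 1"
proof -
  have "filterlim (\<lambda>k. (1 + y) + real k) at_top sequentially"
    by (rule filterlim_tendsto_add_at_top[OF tendsto_const filterlim_real_sequentially])
  then have "(\<lambda>k. (1 + y) / ((1 + y) + real k)) \<longlonglongrightarrow> 0"
    by (intro tendsto_divide_0[OF tendsto_const] filterlim_at_top_imp_at_infinity)
  then have "(\<lambda>k. (1 + y) / (real k + 1 + y)) \<longlonglongrightarrow> 0"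
    by (simp add: add_ac)
  from telescope_sums'[OF this] show ?thesis
    using assms by (simp add: gauss_prob_diff)
qed

lemma inverse_digit_mem:
  assumes "(0::real) \<le> y"
  shows "1 / (real k + 1 + y) \<in> {0..1}"
  using assms by (simp add: divide_simps)

lemma gauss_op_summable:
  assumes "0 \<le> y" "f \<in> {0..1} \<rightarrow> {0..1}"
  shows "summable (\<lambda>k. gauss_prob k y * f (1 / (real k + 1 + y)))"
proof (rule summable_comparison_test')
  show "summable (\<lambda>k. gauss_prob k y)"
    using gauss_prob_sums[OF assms(1)] by (rule sums_summable)
  show "norm (gauss_prob k y * f (1 / (real k + 1 + y))) \<le> gauss_prob k y" for k
    using gauss_prob_nonneg[OF assms(1), of k] inverse_digit_mem[OF assms(1), of k] assms(2)
    by (auto simp: Pi_iff abs_mult intro: mult_left_le)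
qed

text \<open>The unordered form of the series: iterates of the operator become sums over words, which
  have no preferred enumeration.\<close>

lemma gauss_op_has_sum:
  assumes "0 \<le> y" "f \<in> {0..1} \<rightarrow> {0..1}"
  shows "((\<lambda>k. gauss_prob k y * f (1 / (real k + 1 + y))) has_sum gauss_op f y) UNIV"
proof (rule sums_nonneg_imp_has_sum)
  show "(\<lambda>k. gauss_prob k y * f (1 / (real k + 1 + y))) sums gauss_op f y"
    unfolding gauss_op_def using gauss_op_summable[OF assms] by (rule summable_sums)
  show "0 \<le> gauss_prob k y * f (1 / (real k + 1 + y))" for k
    using gauss_prob_nonneg[OF assms(1), of k] inverse_digit_mem[OF assms(1), of k] assms(2)
    by (auto simp: Pi_iff)
qed

lemma gauss_op_mem:
  assumes "f \<in> {0..1} \<rightarrow> {0..1}"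
  shows "gauss_op f \<in> {0..1} \<rightarrow> {0..1}"
proof
  fix y :: real assume y: "y \<in> {0..1}"
  note s = gauss_op_summable[OF _ assms, of y]
  have b: "0 \<le> f (1 / (real k + 1 + y))" "f (1 / (real k + 1 + y)) \<le> 1" for k
    using inverse_digit_mem[of y k] assms y by (auto simp: Pi_iff)
  have "0 \<le> gauss_op f y"
    unfolding gauss_op_def using y b gauss_prob_nonneg s by (intro suminf_nonneg) auto
  moreover have "gauss_op f y \<le> (\<Sum>k. gauss_prob k y)"
    unfolding gauss_op_def using y b gauss_prob_nonneg s sums_summable[OF gauss_prob_sums, of y]
    by (intro suminf_le) (auto intro: mult_left_le)
  ultimately show "gauss_op f y \<in> {0..1}"
    using sums_unique[OF gauss_prob_sums, of y] y by simp
qed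

text \<open>The weights sum to 1. Passing to \<open>1 - f\<close> exchanges increasing and
  decreasing functions, which reduces the contraction to increasing ones.\<close>

lemma gauss_op_compl:
  assumes "0 \<le> y" "f \<in> {0..1} \<rightarrow> {0..1}"
  shows "gauss_op (\<lambda>x. 1 - f x) y = 1 - gauss_op f y"
proof -
  have "gauss_op (\<lambda>x. 1 - f x) y
      = (\<Sum>k. gauss_prob k y - gauss_prob k y * f (1 / (real k + 1 + y)))"
    unfolding gauss_op_def by (simp add: algebra_simps)
  also have "\<dots> = (\<Sum>k. gauss_prob k y) - gauss_op f y"
    unfolding gauss_op_def
    by (rule suminf_diff[symmetric])
       (use sums_summable[OF gauss_prob_sums[OF assms(1)]] gauss_op_summable[OF assms] in auto)
  finally show ?thesis
    using sums_unique[OF gauss_prob_sums[OF assms(1)]] by simp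
qed

text \<open>As \<open>y\<close> grows, the distribution \<open>gauss_prob\<close> moves its mass to larger digits, since its
  tails \<open>(1 + y) / (m + 1 + y)\<close> increase; this is summation by parts against a decreasing
  sequence.\<close>

lemma gauss_prob_stochastic_mono:
  fixes c :: "nat \<Rightarrow> real"
  assumes "0 \<le> x" "x \<le> y" "decseq c" "\<And>k. 0 \<le> c k"
  shows "(\<Sum>k<N. gauss_prob k y * c k) \<le> (\<Sum>k<N. gauss_prob k x * c k)"
proof -
  \<comment> \<open>\<open>R m\<close> is the difference between the masses that \<open>y\<close>
    and \<open>x\<close> give to the indices \<open>k \<ge> m\<close>.\<close>
  define R where "R m = (1 + y) / (real m + 1 + y) - (1 + x) / (real m + 1 + x)" for m
  have R: "0 \<le> R m" for m
    using assms(1,2) by (simp add: R_def divide_simps) (simp add: algebra_simps mult_right_mono)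
  \<comment> \<open>The right-hand side is the boundary term of the summation by parts; keeping it
    makes the induction close.\<close>
  have "(\<Sum>k<N. (gauss_prob k y - gauss_prob k x) * c k) \<le> - (R N * c N)"
  proof (induction N)
    case 0
    have "R 0 = 0" using assms(1,2) by (simp add: R_def)
    then show ?case by simp
  next
    case (Suc N)
    have "(gauss_prob N y - gauss_prob N x) * c N = R N * c N - R (Suc N) * c N"
      using assms(1,2) by (simp add: gauss_prob_diff R_def algebra_simps)
    moreover have "R (Suc N) * c (Suc N) \<le> R (Suc N) * c N"
      using R assms(3) by (intro mult_left_mono) (auto simp: decseq_Suc_iff)
    ultimately show ?case using Suc.IH by simp
  qed
  moreover have "0 \<le> R N * c N" using R assms(4) by simp
  ultimately show ?thesis by (simp add: algebra_simps sum_subtractf)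
qed

text \<open>Two effects agree as \<open>y\<close> grows: each evaluation point
  \<open>1 / (real k + 1 + y)\<close> moves left, and the mass moves to larger digits, whose
  evaluation points lie further left.\<close>

lemma gauss_op_antimono:
  assumes "f \<in> {0..1} \<rightarrow> {0..1}" "mono_on {0..1} f"
  shows "antimono_on {0..1} (gauss_op f)"
proof (rule monotone_onI)
  fix x y :: real assume xy: "x \<in> {0..1}" "y \<in> {0..1}" "x \<le> y"
  define c where "c k = f (1 / (real k + 1 + x))" for k
  have c0: "0 \<le> c k" for k
    using inverse_digit_mem[of x k] xy assms(1) by (auto simp: c_def Pi_iff)
  have dec: "decseq c"
    unfolding decseq_Suc_iff c_def using inverse_digit_mem[of x] xy
    by (intro allI mono_onD[OF assms(2)]) (auto simp: divide_simps)
  have le: "f (1 / (real k + 1 + y)) \<le> c k" for k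
    unfolding c_def using inverse_digit_mem[of x k] inverse_digit_mem[of y k] xy
    by (intro mono_onD[OF assms(2)]) (auto intro!: divide_left_mono)
  show "gauss_op f y \<le> gauss_op f x"
    unfolding gauss_op_def
  proof (rule LIMSEQ_le)
    show "(\<lambda>N. \<Sum>k<N. gauss_prob k y * f (1 / (real k + 1 + y))) \<longlonglongrightarrow>
        (\<Sum>k. gauss_prob k y * f (1 / (real k + 1 + y)))"
      using gauss_op_summable assms(1) xy by (intro summable_LIMSEQ) auto
    show "(\<lambda>N. \<Sum>k<N. gauss_prob k x * f (1 / (real k + 1 + x))) \<longlonglongrightarrow>
        (\<Sum>k. gauss_prob k x * f (1 / (real k + 1 + x)))"
      using gauss_op_summable assms(1) xy by (intro summable_LIMSEQ) auto
    have "(\<Sum>k<N. gauss_prob k y * f (1 / (real k + 1 + y)))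
        \<le> (\<Sum>k<N. gauss_prob k x * f (1 / (real k + 1 + x)))" for N
    proof -
      have "(\<Sum>k<N. gauss_prob k y * f (1 / (real k + 1 + y))) \<le> (\<Sum>k<N. gauss_prob k y * c k)"
        using xy le gauss_prob_nonneg by (intro sum_mono mult_left_mono) auto
      also have "\<dots> \<le> (\<Sum>k<N. gauss_prob k x * c k)"
        using xy dec c0 by (intro gauss_prob_stochastic_mono) auto
      finally show ?thesis unfolding c_def .
    qed
    then show "\<exists>N. \<forall>n\<ge>N. (\<Sum>k<n. gauss_prob k y * f (1 / (real k + 1 + y)))
        \<le> (\<Sum>k<n. gauss_prob k x * f (1 / (real k + 1 + x)))"
      by blast
  qed
qed

text \<open>The contraction rests on \<open>gauss_prob k 1 = 2 * gauss_prob (Suc k) 0\<close> and the coincidence of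
  the corresponding evaluation points.\<close>

lemma gauss_op_oscillation:
  assumes "f \<in> {0..1} \<rightarrow> {0..1}" "mono_on {0..1} f"
  shows "\<bar>gauss_op f 1 - gauss_op f 0\<bar> \<le> (f 1 - f 0) / 2"
proof -
  let ?a = "\<lambda>k. gauss_prob k 0 * f (1 / (real k + 1 + 0))"
  have s: "summable ?a" using gauss_op_summable[of 0 f] assms(1) by simp
  have "gauss_op f 1 = (\<Sum>k. 2 * ?a (Suc k))"
    unfolding gauss_op_def
    by (intro arg_cong[where f = suminf] ext) (simp add: gauss_prob_def divide_simps add_ac)
  also have "\<dots> = 2 * (\<Sum>k. ?a (Suc k))"
    using s summable_Suc_iff[of ?a] by (intro suminf_mult) blast
  finally have 1: "gauss_op f 1 = 2 * (\<Sum>k. ?a (Suc k))" .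
  have 2: "gauss_op f 0 = f 1 / 2 + (\<Sum>k. ?a (Suc k))"
    unfolding gauss_op_def using suminf_split_head[OF s] by (simp add: gauss_prob_def)
  have p0: "(\<Sum>k. gauss_prob (Suc k) 0) = 1 / 2"
    using suminf_split_head[OF sums_summable[OF gauss_prob_sums[of 0]]]
      sums_unique[OF gauss_prob_sums[of 0]]
    by (simp add: gauss_prob_def)
  have sp: "summable (\<lambda>k. gauss_prob (Suc k) 0)"
    using sums_summable[OF gauss_prob_sums[of 0]] summable_Suc_iff[of "\<lambda>k. gauss_prob k 0"]
    by simp
  \<comment> \<open>Let \<open>S\<close> be the sum over the indices from 1 on at the point 0. These
    carry mass 1/2, so \<open>S \<ge> f 0 / 2\<close>, and the endpoint difference to be bounded is
    \<open>f 1 / 2 - S\<close>.\<close>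
  have "f 0 / 2 = (\<Sum>k. gauss_prob (Suc k) 0 * f 0)"
    using suminf_mult2[OF sp, of "f 0"] p0 by simp
  also have "\<dots> \<le> (\<Sum>k. ?a (Suc k))"
  proof (rule suminf_le)
    show "summable (\<lambda>k. gauss_prob (Suc k) 0 * f 0)" using sp by (rule summable_mult2)
    show "summable (\<lambda>k. ?a (Suc k))" using s summable_Suc_iff[of ?a] by blast
    show "gauss_prob (Suc k) 0 * f 0 \<le> ?a (Suc k)" for k
      using inverse_digit_mem[of 0 "Suc k"]
      by (intro mult_left_mono gauss_prob_nonneg mono_onD[OF assms(2)]) auto
  qed
  finally have 3: "f 0 / 2 \<le> (\<Sum>k. ?a (Suc k))" .
  have "gauss_op f 1 \<le> gauss_op f 0"
    using monotone_onD[OF gauss_op_antimono[OF assms], of 0 1] by simp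
  then show ?thesis using 1 2 3 by (simp add: field_simps)
qed

definition monotone_fraction :: "(real \<Rightarrow> real) \<Rightarrow> bool" where
  "monotone_fraction f \<longleftrightarrow>
     f \<in> {0..1} \<rightarrow> {0..1} \<and> (mono_on {0..1} f \<or> antimono_on {0..1} f)"

lemma monotone_fraction_gauss_op:
  assumes "monotone_fraction f"
  shows "monotone_fraction (gauss_op f)"
    and "\<bar>gauss_op f 1 - gauss_op f 0\<bar> \<le> \<bar>f 1 - f 0\<bar> / 2"
proof -
  have f: "f \<in> {0..1} \<rightarrow> {0..1}" using assms by (simp add: monotone_fraction_def)
  have "(mono_on {0..1} (gauss_op f) \<or> antimono_on {0..1} (gauss_op f)) \<and>
      \<bar>gauss_op f 1 - gauss_op f 0\<bar> \<le> \<bar>f 1 - f 0\<bar> / 2"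
  proof (cases "mono_on {0..1} f")
    case True
    then show ?thesis
      using gauss_op_antimono[OF f] gauss_op_oscillation[OF f] by fastforce
  next
    case False
    let ?g = "\<lambda>x. 1 - f x"
    have g: "?g \<in> {0..1} \<rightarrow> {0..1}" using f by (auto simp: Pi_iff)
    have gm: "mono_on {0..1} ?g"
      using False assms by (auto simp: monotone_fraction_def monotone_on_def)
    have eq: "gauss_op f y = 1 - gauss_op ?g y" if "0 \<le> y" for y
      using gauss_op_compl[OF that f] by simp
    have "mono_on {0..1} (gauss_op f)"
      using gauss_op_antimono[OF g gm] by (auto simp: monotone_on_def eq)
    then show ?thesis
      using gauss_op_oscillation[OF g gm] eq[of 0] eq[of 1] by (simp add: abs_minus_commute)
  qed
  then show "monotone_fraction (gauss_op f)" "\<bar>gauss_op f 1 - gauss_op f 0\<bar> \<le> \<bar>f 1 - f 0\<bar> / 2"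
    using gauss_op_mem[OF f] by (auto simp: monotone_fraction_def)
qed

lemma gauss_op_iterate_oscillation:
  assumes "monotone_fraction f"
  shows "monotone_fraction ((gauss_op ^^ n) f)"
    and "\<And>x y. x \<in> {0..1} \<Longrightarrow> y \<in> {0..1} \<Longrightarrow>
      \<bar>(gauss_op ^^ n) f x - (gauss_op ^^ n) f y\<bar> \<le> 1 / 2 ^ n"
proof -
  have *: "monotone_fraction ((gauss_op ^^ n) f) \<and>
      \<bar>(gauss_op ^^ n) f 1 - (gauss_op ^^ n) f 0\<bar> \<le> 1 / 2 ^ n"
  proof (induction n)
    case 0
    have "f 0 \<in> {0..1}" "f 1 \<in> {0..1}" using assms by (auto simp: monotone_fraction_def Pi_iff)
    then show ?case using assms by auto
  next
    case (Suc n)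
    then show ?case using monotone_fraction_gauss_op[of "(gauss_op ^^ n) f"] by simp
  qed
  then show "monotone_fraction ((gauss_op ^^ n) f)" by simp
  fix x y :: real assume xy: "x \<in> {0..1}" "y \<in> {0..1}"
  let ?g = "(gauss_op ^^ n) f"
  \<comment> \<open>A monotone function lies between its endpoint values, so the endpoint bound
    controls every pair of points.\<close>
  have "min (?g 0) (?g 1) \<le> ?g z \<and> ?g z \<le> max (?g 0) (?g 1)" if "z \<in> {0..1}" for z
    using * that monotone_onD[of "{0..1}" _ _ ?g 0 z] monotone_onD[of "{0..1}" _ _ ?g z 1]
    by (fastforce simp: monotone_fraction_def monotone_on_def)
  from this[OF xy(1)] this[OF xy(2)] * show "\<bar>?g x - ?g y\<bar> \<le> 1 / 2 ^ n"
    by (auto simp: min_def max_def split: if_splits)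
qed

section \<open>Inverse branches and their distortion\<close>

text \<open>The digit \<open>k\<close> of a word stands for the continued fraction digit \<open>k + 1\<close>.\<close>

primrec branch :: "nat list \<Rightarrow> real \<Rightarrow> real" where
  "branch [] y = y"
| "branch (k # a) y = 1 / (real k + 1 + branch a y)"

text \<open>In terms of the convergent denominators \<open>q\<^sub>n\<close>, this is \<open>q\<^sub>n + y q\<^sub>n\<^sub>-\<^sub>1\<close>.\<close>

primrec denom :: "nat list \<Rightarrow> real \<Rightarrow> real" where
  "denom [] y = 1"
| "denom (k # a) y = denom a y * (real k + 1 + branch a y)"

section \<open>Growth of denominators and contraction of branches\<close>

lemma branch_nonneg: "0 \<le> y \<Longrightarrow> 0 \<le> branch a y"
  by (induction a) auto

lemma branch_pos: "0 < y \<or> a \<noteq> [] \<and> 0 \<le> y \<Longrightarrow> 0 < branch a y"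
  by (cases a) (auto simp: branch_nonneg add_pos_nonneg)

lemma branch_mem:
  assumes "y \<in> {0..1}"
  shows "branch a y \<in> {0..1}"
  using assms inverse_digit_mem[OF branch_nonneg] by (cases a) auto

lemma denom_ge_1: "0 \<le> y \<Longrightarrow> 1 \<le> denom a y"
proof (induction a)
  case (Cons k a)
  then have "1 * 1 \<le> denom a y * (real k + 1 + branch a y)"
    using branch_nonneg[of y a] by (intro mult_mono) auto
  then show ?case by simp
qed simp

text \<open>The recurrence of the convergent denominators, \<open>denom (k # l # a) y = (real k + 1)
  * denom (l # a) y + denom a y\<close>, adds at least 1 per letter. Linear growth suffices for the
  error terms below.\<close>

lemma denom_ge_length:
  assumes "0 \<le> y"
  shows "real (length a) \<le> denom a y"
proof (induction a rule: induct_list012)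
  case (2 k)
  then show ?case using assms by simp
next
  case (3 k l a)
  let ?b = "branch a y" and ?D = "denom a y"
  have "branch (l # a) y * denom (l # a) y = ?D"
    using branch_nonneg[OF assms, of a] by simp
  then have "denom (k # l # a) y = (real k + 1) * denom (l # a) y + ?D"
    by (simp add: algebra_simps del: denom.simps(2) branch.simps(2) add: denom.simps(2)[of k])
  moreover have "real k * denom (l # a) y \<ge> 0"
    using denom_ge_1[OF assms, of "l # a"] by (simp del: denom.simps)
  moreover have "real (length (k # l # a)) = real (length (l # a)) + 1" by simp
  ultimately show ?case
    using 3(2) denom_ge_1[OF assms, of a] unfolding distrib_right by linarith
qed simp

text \<open>A branch is a Moebius map of determinant 1 or -1, so the difference quotient is known
  exactly.\<close>

lemma branch_diff:
  assumes "0 \<le> x" "0 \<le> y"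
  shows "\<bar>branch a x - branch a y\<bar> = \<bar>x - y\<bar> / (denom a x * denom a y)"
proof (induction a)
  case (Cons k a)
  let ?p = "real k + 1 + branch a x" and ?q = "real k + 1 + branch a y"
  have pq: "?p > 0" "?q > 0"
    using branch_nonneg[OF assms(1), of a] branch_nonneg[OF assms(2), of a] by auto
  then have "1 / ?p - 1 / ?q = (branch a y - branch a x) / (?p * ?q)"
    by (simp add: divide_simps)
  then have "\<bar>1 / ?p - 1 / ?q\<bar> = \<bar>branch a x - branch a y\<bar> / (?p * ?q)"
    using pq by (simp add: abs_mult abs_minus_commute)
  then show ?case using Cons.IH by (simp add: mult_ac)
qed simp

lemma branch_contract:
  assumes "x \<in> {0..1}" "y \<in> {0..1}" "length a = n" "0 < n"
  shows "\<bar>branch a x - branch a y\<bar> \<le> 1 / real n ^ 2"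
proof -
  have "real n * real n \<le> denom a x * denom a y"
    using denom_ge_length[of x a] denom_ge_length[of y a] assms by (intro mult_mono) auto
  moreover have "\<bar>x - y\<bar> \<le> 1" using assms by auto
  ultimately show ?thesis
    using assms by (subst branch_diff) (auto simp: power2_eq_square intro!: frac_le)
qed

text \<open>Here \<open>A\<close> and \<open>B\<close> are consecutive convergent denominators. What
  matters is \<open>B \<le> A\<close>: the slope never exceeds the constant term, uniformly in the
  word.\<close>

lemma denom_affine:
  "\<exists>A B :: real. 0 \<le> B \<and> B \<le> A \<and> 1 \<le> A \<and> (\<forall>y\<ge>0. denom a y = A + B * y)"
proof -
  \<comment> \<open>The numerator \<open>C + E * y\<close> of the branch is carried along, since a
    new letter adds it to a multiple of the denominator. The inequality
    \<open>B + E \<le> A + C\<close> then preserves \<open>B \<le> A\<close>.\<close>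
  have "\<exists>A B C E :: real. 0 \<le> B \<and> B \<le> A \<and> 1 \<le> A \<and> 0 \<le> C \<and> 0 \<le> E \<and> B + E \<le> A + C \<and>
      (\<forall>y\<ge>0. denom a y = A + B * y \<and> branch a y * denom a y = C + E * y)"
  proof (induction a)
    case Nil
    show ?case by (rule exI[of _ 1], rule exI[of _ 0], rule exI[of _ 0], rule exI[of _ 1]) simp
  next
    case (Cons k a)
    then obtain A B C E :: real where *: "0 \<le> B" "B \<le> A" "1 \<le> A" "0 \<le> C" "0 \<le> E" "B + E \<le> A + C"
      and eqs: "\<forall>y\<ge>0. denom a y = A + B * y \<and> branch a y * denom a y = C + E * y"
      by (elim exE conjE) rule
    let ?A = "(real k + 1) * A + C" and ?B = "(real k + 1) * B + E"
    have kB: "real k * B \<le> real k * A" "0 \<le> real k * B" "0 \<le> real k * A"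
      using * by (auto intro: mult_left_mono)
    have step: "\<forall>y\<ge>0. denom (k # a) y = ?A + ?B * y \<and> branch (k # a) y * denom (k # a) y = A + B * y"
    proof (intro allI impI conjI)
      fix y :: real assume that: "0 \<le> y"
      have eq: "denom a y = A + B * y" "branch a y * denom a y = C + E * y"
        using eqs that by blast+
      have "denom (k # a) y = (real k + 1) * denom a y + branch a y * denom a y"
        by (simp add: algebra_simps)
      also have "\<dots> = (real k + 1) * (A + B * y) + (C + E * y)"
        by (simp only: eq(2)) (simp only: eq(1))
      finally show "denom (k # a) y = ?A + ?B * y" by (simp add: algebra_simps)
      have "branch (k # a) y * denom (k # a) y = denom a y"
        using branch_nonneg[OF that, of a] by simp
      then show "branch (k # a) y * denom (k # a) y = A + B * y" by (simp only: eq(1))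
    qed
    have bounds: "0 \<le> ?B" "?B \<le> ?A" "1 \<le> ?A" "?B + B \<le> ?A + A"
      using * kB unfolding distrib_right by linarith+
    show ?case
      by (rule exI[of _ ?A], rule exI[of _ ?B], rule exI[of _ A], rule exI[of _ B],
          intro conjI bounds step *(1)) (use *(3) in simp)
  qed
  then show ?thesis
    by fast
qed

text \<open>Moving the argument by \<open>r\<close> changes the affine function by at most
  \<open>B * r\<close>, and \<open>B \<le> A \<le> denom a y\<close>.\<close>

lemma denom_distortion:
  assumes "0 \<le> x" "0 \<le> y"
  shows "denom a x \<le> (1 + \<bar>x - y\<bar>) * denom a y"
proof -
  obtain A B :: real where *: "0 \<le> B" "B \<le> A" "1 \<le> A" "\<And>y. 0 \<le> y \<Longrightarrow> denom a y = A + B * y"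
    using denom_affine[of a] by blast
  have "A + B * x \<le> A + B * y + B * \<bar>x - y\<bar>"
    using *(1) mult_left_mono[of x "y + \<bar>x - y\<bar>" B] by (simp add: algebra_simps)
  also have "B * \<bar>x - y\<bar> \<le> (A + B * y) * \<bar>x - y\<bar>"
    using *(2) mult_nonneg_nonneg[OF *(1) assms(2)] by (intro mult_right_mono) linarith+
  finally show ?thesis using *(4) assms by (simp add: algebra_simps)
qed

text \<open>This is \<open>\<bar>\<psi>'(y)\<bar> h (\<psi> y) / h y\<close> for the branch \<open>\<psi>\<close> of the word and the Gauss density \<open>h\<close>.\<close>

definition word_prob :: "nat list \<Rightarrow> real \<Rightarrow> real" where
  "word_prob a y = (1 + y) / ((1 + branch a y) * denom a y ^ 2)"

lemma word_prob_nonneg: "0 \<le> y \<Longrightarrow> 0 \<le> word_prob a y"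
  using branch_nonneg[of y a] by (simp add: word_prob_def)

lemma word_prob_Nil: "0 \<le> y \<Longrightarrow> word_prob [] y = 1"
  by (simp add: word_prob_def)

text \<open>The chain rule: the first letter is the outermost branch, so its probability is taken at
  \<open>branch a y\<close>. Thus \<open>word_prob\<close> is a product of transition
  probabilities.\<close>

lemma word_prob_Cons:
  assumes "0 \<le> y"
  shows "word_prob (k # a) y = word_prob a y * gauss_prob k (branch a y)"
proof -
  define z where "z = branch a y"
  have z: "0 \<le> z" unfolding z_def by (rule branch_nonneg[OF assms])
  have "(1 + 1 / (real k + 1 + z)) * (real k + 1 + z) = real k + 2 + z"
    using z by (simp add: field_simps)
  then have eq: "(1 + 1 / (real k + 1 + z)) * (denom a y * (real k + 1 + z))\<^sup>2 =
      (denom a y)\<^sup>2 * ((real k + 1 + z) * (real k + 2 + z))"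
    by (simp add: power2_eq_square mult_ac)
  show ?thesis
    using z denom_ge_1[OF assms, of a]
    by (simp add: word_prob_def gauss_prob_def eq mult_ac flip: z_def)
qed

lemma bij_betw_Cons_length:
  "bij_betw (\<lambda>(a, k). k # a) (SIGMA a : {a. length a = n}. UNIV) {a. length a = Suc n}"
  by (rule bij_betwI[where g = "\<lambda>a. (tl a, hd a)"]) (auto simp: length_Suc_conv)

text \<open>The induction expands the operator standing next to \<open>f\<close>, which puts the new
  letter in front of the word. Nonnegativity allows the double sum to be taken over pairs.\<close>

lemma gauss_op_iterate_has_sum:
  assumes "y \<in> {0..1}" "f \<in> {0..1} \<rightarrow> {0..1}"
  shows "((\<lambda>a. word_prob a y * f (branch a y)) has_sum (gauss_op ^^ n) f y) {a. length a = n}"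
  using assms(2)
proof (induction n arbitrary: f)
  case 0
  show ?case
    using has_sum_finite[of "{[]}" "\<lambda>a. word_prob a y * f (branch a y)"] assms(1)
    by (simp add: word_prob_Nil)
next
  case (Suc n)
  let ?g = "\<lambda>(a, k). word_prob (k # a) y * f (branch (k # a) y)"
  have y: "0 \<le> y" using assms(1) by simp
  have IH: "((\<lambda>a. word_prob a y * gauss_op f (branch a y)) has_sum (gauss_op ^^ n) (gauss_op f) y)
      {a. length a = n}"
    by (rule Suc.IH[OF gauss_op_mem[OF Suc.prems]])
  have inner: "((\<lambda>k. ?g (a, k)) has_sum word_prob a y * gauss_op f (branch a y)) UNIV" for a
    using has_sum_cmult_right[OF gauss_op_has_sum[OF branch_nonneg[OF y, of a] Suc.prems],
        of "word_prob a y"]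
    by (simp add: word_prob_Cons[OF y] mult.assoc)
  have nonneg: "0 \<le> ?g (a, k)" for a k
    using branch_mem[OF assms(1), of "k # a"] word_prob_nonneg[OF y, of "k # a"] Suc.prems
    by (auto simp: Pi_iff simp del: branch.simps)
  have "(?g has_sum (gauss_op ^^ n) (gauss_op f) y) (SIGMA a : {a. length a = n}. UNIV)"
  proof (rule has_sum_SigmaI[OF inner IH])
    show "?g summable_on (SIGMA a : {a. length a = n}. UNIV)"
      using nonneg by (intro summable_on_SigmaI[OF inner has_sum_imp_summable[OF IH]])
  qed
  then show ?case
    unfolding has_sum_reindex_bij_betw[OF bij_betw_Cons_length, symmetric]
    by (simp add: case_prod_unfold funpow_swap1)
qed

text \<open>The two values of the Gauss density cancel and the modulus of the derivative of the
  branch remains.\<close>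

lemma word_prob_fixed_point:
  assumes "0 \<le> x" "branch a x = x"
  shows "word_prob a x = 1 / denom a x ^ 2"
  using assms by (simp add: word_prob_def)

text \<open>Two factors \<open>1 + d\<close> come from the squared denominator and one from the
  density ratio. As \<open>x\<close> is fixed by the branch, \<open>branch a y\<close> is within
  \<open>1 / real n ^ 2\<close> of \<open>x\<close>, hence within \<open>d\<close> of
  \<open>y\<close>.\<close>

lemma word_prob_distortion:
  assumes "x \<in> {0..1}" "y \<in> {0..1}" "branch a x = x" "length a = n" "0 < n"
    and d: "\<bar>x - y\<bar> + 1 / real n ^ 2 \<le> d"
  shows "word_prob a x \<le> (1 + d) ^ 3 * word_prob a y"
    and "word_prob a y \<le> (1 + d) ^ 3 * word_prob a x"
proof -
  define z where "z = branch a y"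
  have z: "0 \<le> z" "\<bar>x - z\<bar> \<le> 1 / real n ^ 2"
    using branch_nonneg[of y a] branch_contract[of x y a n] assms by (auto simp: z_def)
  have n2: "0 \<le> 1 / real n ^ 2" by simp
  have d0: "0 \<le> d" "\<bar>x - y\<bar> \<le> d" "\<bar>y - z\<bar> \<le> d" using d z n2 by linarith+
  have ratio: "1 + u \<le> (1 + d) * (1 + v)" if "0 \<le> v" "\<bar>u - v\<bar> \<le> d" for u v
  proof -
    have "0 \<le> d * v" using that(1) d0(1) by simp
    then show ?thesis using that unfolding distrib_left distrib_right by linarith
  qed
  have D: "denom a u ^ 2 \<le> (1 + d) ^ 2 * denom a v ^ 2" if "0 \<le> u" "0 \<le> v" "\<bar>u - v\<bar> \<le> d" for u v
  proof -
    have "denom a u \<le> (1 + \<bar>u - v\<bar>) * denom a v" by (rule denom_distortion[OF that(1,2)])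
    also have "\<dots> \<le> (1 + d) * denom a v"
      using that denom_ge_1[OF that(2), of a] by (intro mult_right_mono) auto
    finally have "denom a u ^ 2 \<le> ((1 + d) * denom a v) ^ 2"
      using denom_ge_1[OF that(1), of a] by (intro power_mono) auto
    then show ?thesis by (simp add: power_mult_distrib)
  qed
  have pos: "0 < denom a x ^ 2" "0 < denom a y ^ 2"
    using denom_ge_1[of x a] denom_ge_1[of y a] assms by (auto intro!: zero_less_power)
  define q r where "q = denom a x ^ 2" and "r = denom a y ^ 2"
  have wx: "word_prob a x = 1 / q"
    using word_prob_fixed_point assms by (simp add: q_def)
  have wy: "word_prob a y = (1 + y) / ((1 + z) * r)"
    by (simp add: word_prob_def z_def r_def)
  have qr: "0 < q" "0 < r" "0 < 1 + z" "0 \<le> y" using pos z assms by (auto simp: q_def r_def)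
  have "(1 + z) * r \<le> ((1 + d) * (1 + y)) * ((1 + d) ^ 2 * q)" unfolding q_def r_def
    using D[of y x] ratio[of y z] assms z d0 pos by (intro mult_mono) (auto simp: abs_minus_commute)
  then have "(1 + z) * r * 1 \<le> (1 + d) ^ 3 * (1 + y) * q"
    by (simp add: power3_eq_cube power2_eq_square mult_ac)
  then have "1 / q \<le> ((1 + d) ^ 3 * (1 + y)) / ((1 + z) * r)"
    using qr by (simp add: pos_divide_le_eq pos_le_divide_eq mult_ac)
  then show "word_prob a x \<le> (1 + d) ^ 3 * word_prob a y" by (simp add: wx wy)
  have "(1 + y) * q \<le> ((1 + d) * (1 + z)) * ((1 + d) ^ 2 * r)" unfolding q_def r_def
    using D[of x y] ratio[of z y] assms z d0 pos by (intro mult_mono) (auto simp: abs_minus_commute)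
  then have "(1 + y) * q \<le> (1 + d) ^ 3 * ((1 + z) * r)"
    by (simp add: power3_eq_cube power2_eq_square mult_ac)
  then have "(1 + y) / ((1 + z) * r) \<le> (1 + d) ^ 3 / q"
    using qr by (simp add: pos_divide_le_eq pos_le_divide_eq mult_ac)
  then show "word_prob a y \<le> (1 + d) ^ 3 * word_prob a x" by (simp add: wx wy)
qed

section \<open>Periodic points\<close>

lemma irr01_bounds: "x \<in> irr01 \<Longrightarrow> 0 < x" "x \<in> irr01 \<Longrightarrow> x < 1" "x \<in> irr01 \<Longrightarrow> x \<in> {0..1}"
  by (auto simp: irr01_def)

lemma inverse_digit_irr01:
  assumes "z \<in> irr01"
  shows "1 / (real k + 1 + z) \<in> irr01"
proof -
  have "1 / (real k + 1 + z) \<notin> \<rat>"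
  proof
    assume "1 / (real k + 1 + z) \<in> \<rat>"
    then have "inverse (1 / (real k + 1 + z)) - (real k + 1) \<in> \<rat>"
      by (intro Rats_diff Rats_inverse Rats_add) auto
    then show False using assms by (simp add: irr01_def)
  qed
  then show ?thesis
    using irr01_bounds[OF assms] by (simp add: irr01_def)
qed

lemma branch_irr01: "y \<in> irr01 \<Longrightarrow> branch a y \<in> irr01"
  by (induction a) (auto simp: inverse_digit_irr01)

lemma floor_inverse_digit:
  assumes "z \<in> irr01"
  shows "\<lfloor>real k + 1 + z\<rfloor> = int k + 1"
  using irr01_bounds[OF assms] by (simp add: floor_eq_iff)

lemma gauss_map_inverse_digit:
  assumes "z \<in> irr01"
  shows "gauss_map (1 / (real k + 1 + z)) = z"
  using floor_inverse_digit[OF assms, of k] by (simp add: gauss_map_def)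

lemma gauss_map_funpow_branch:
  assumes "y \<in> irr01"
  shows "(gauss_map ^^ length a) (branch a y) = y"
proof (induction a)
  case (Cons k a)
  have "gauss_map (branch (k # a) y) = branch a y"
    using gauss_map_inverse_digit[OF branch_irr01[OF assms]] by simp
  then show ?case
    using Cons.IH by (simp add: funpow_Suc_right del: funpow.simps branch.simps)
qed simp

text \<open>The leading digit is the floor of the reciprocal, since the remainder lies strictly
  between 0 and 1.\<close>

lemma branch_eq_imp:
  assumes "x \<in> irr01" "y \<in> irr01" "length a = length b" "branch a x = branch b y"
  shows "a = b"
  using assms(3,4)
proof (induction a b rule: list_induct2)
  case (Cons k a l b)
  let ?p = "real k + 1 + branch a x" and ?q = "real l + 1 + branch b y"
  have "?p = ?q"
    using Cons.prems by simp
  moreover have "\<lfloor>?p\<rfloor> = int k + 1" "\<lfloor>?q\<rfloor> = int l + 1"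
    using floor_inverse_digit branch_irr01 assms(1,2) by blast+
  ultimately have "int k + 1 = int l + 1" by metis
  then show ?case using \<open>?p = ?q\<close> Cons.IH by simp
qed simp

lemma irr01_eq_branch:
  assumes "x \<in> irr01"
  shows "\<exists>a. length a = n \<and> x = branch a ((gauss_map ^^ n) x)"
  using assms
proof (induction n arbitrary: x)
  case 0
  show ?case by (intro exI[of _ "[]"]) simp
next
  case (Suc n)
  obtain a where a: "length a = n" "gauss_map x = branch a ((gauss_map ^^ n) (gauss_map x))"
    using Suc.IH[OF gauss_map_irr01[OF Suc.prems]] by blast
  \<comment> \<open>Letters start at 0 and digits at 1, hence the shift by one.\<close>
  define k where "k = nat (\<lfloor>1 / x\<rfloor> - 1)"
  have "1 \<le> 1 / x" using irr01_bounds[OF Suc.prems] by simp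
  then have "real k + 1 = of_int \<lfloor>1 / x\<rfloor>"
    by (simp add: k_def le_floor_iff)
  then have "real k + 1 + gauss_map x = 1 / x"
    by (simp add: gauss_map_def)
  then have "x = branch (k # a) ((gauss_map ^^ Suc n) x)"
    using a(2) by (simp add: funpow_swap1)
  then show ?case using a(1) by (intro exI[of _ "k # a"]) simp
qed

text \<open>Near \<open>x\<close> the floor of \<open>1 / u\<close> is constant, because an
  irrational \<open>x\<close> is not an endpoint of its digit interval.\<close>

lemma gauss_map_has_derivative:
  assumes "x \<in> irr01"
  shows "(gauss_map has_field_derivative - 1 / x ^ 2) (at x)"
proof -
  define m where "m = \<lfloor>1 / x\<rfloor>"
  have x: "0 < x" "x < 1" using irr01_bounds[OF assms] by auto
  have m: "1 \<le> m" using x by (simp add: m_def le_floor_iff)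
  let ?S = "{1 / (of_int m + 1)<..<1 / of_int m} :: real set"
  have "of_int m \<noteq> 1 / x"
  proof
    assume "of_int m = 1 / x"
    then have "x = 1 / of_int m" by simp
    moreover have "1 / of_int m \<in> (\<rat> :: real set)" by simp
    ultimately show False using assms by (simp add: irr01_def)
  qed
  then have "of_int m < 1 / x" "1 / x < of_int m + 1" unfolding m_def by linarith+
  then have xS: "x \<in> ?S" using x m by (simp add: field_simps)
  have "((\<lambda>u. 1 / u - of_int m) has_field_derivative - 1 / x ^ 2) (at x)"
    using x by (auto intro!: derivative_eq_intros simp: power2_eq_square)
  then show ?thesis
  proof (rule has_field_derivative_transform_within_open[OF _ _ xS])
    fix u assume u: "u \<in> ?S"
    then have "0 < u" using m by (auto intro: less_trans[rotated])
    then have "\<lfloor>1 / u\<rfloor> = m"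
      using u m by (auto simp: floor_eq_iff field_simps)
    then show "1 / u - of_int m = gauss_map u" by (simp add: gauss_map_def)
  qed simp
qed

text \<open>The sign of the derivative alternates with the length of the word, so only its modulus
  is recorded.\<close>

lemma gauss_map_funpow_has_derivative:
  assumes "y \<in> irr01"
  shows "\<exists>D. (gauss_map ^^ length a has_field_derivative D) (at (branch a y)) \<and>
    \<bar>D\<bar> = denom a y ^ 2"
proof (induction a)
  case Nil
  show ?case by (auto intro!: exI[of _ 1] derivative_eq_intros simp: id_def)
next
  case (Cons k a)
  then obtain D where D: "(gauss_map ^^ length a has_field_derivative D) (at (branch a y))"
    "\<bar>D\<bar> = denom a y ^ 2" by blast
  define x where "x = branch (k # a) y"
  have x: "x \<in> irr01" unfolding x_def by (rule branch_irr01[OF assms])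
  have gx: "gauss_map x = branch a y"
    using gauss_map_inverse_digit[OF branch_irr01[OF assms]] by (simp add: x_def)
  have "((gauss_map ^^ length a) \<circ> gauss_map has_field_derivative D * (- 1 / x ^ 2)) (at x)"
    by (rule DERIV_chain) (use D gx gauss_map_has_derivative[OF x] in auto)
  moreover have "\<bar>D * (- 1 / x ^ 2)\<bar> = denom (k # a) y ^ 2"
    using branch_nonneg[of y a] irr01_bounds[OF assms]
    by (simp add: abs_mult D(2) x_def power_mult_distrib power_divide)
  ultimately show ?case
    unfolding x_def[symmetric] length_Cons funpow_Suc_right by blast
qed

text \<open>Reading off digits lowers the denominator of a rational number; hence a periodic point is
  irrational.\<close>

lemma branch_rational_descent:
  assumes "0 < y" "branch a y = real u / real v" "0 < v"
  shows "\<exists>u' v'. 0 < v' \<and> y = real u' / real v' \<and> v' \<le> v \<and> (a \<noteq> [] \<longrightarrow> v' < v)"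
  using assms(2,3)
proof (induction a arbitrary: u v)
  case Nil
  then show ?case by auto
next
  case (Cons k a)
  define z where "z = branch a y"
  have z: "0 < z" unfolding z_def using assms(1) by (intro branch_pos) simp
  have eq: "1 / (real k + 1 + z) = real u / real v" using Cons.prems by (simp add: z_def)
  then have u: "0 < u" using z Cons.prems(2) by (cases u) auto
  have v: "real v = real u * (real k + 1 + z)" using eq z u Cons.prems(2) by (simp add: field_simps)
  then have zu: "z * real u = real v - real u * (real k + 1)" by (simp add: algebra_simps)
  moreover have "0 < z * real u" using z u by simp
  ultimately have "real (u * (k + 1)) < real v" by (simp add: algebra_simps)
  then have less: "u * (k + 1) < v" by (simp only: of_nat_less_iff)
  have "z = real (v - u * (k + 1)) / real u"
    using zu u less by (simp add: of_nat_diff field_simps)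
  then obtain u' v' where "0 < v'" "y = real u' / real v'" "v' \<le> u"
    using Cons.IH[of "v - u * (k + 1)" u] u unfolding z_def by blast
  moreover have "u < v" using less by (simp add: order.strict_trans1[OF _ less])
  ultimately show ?case by fastforce
qed

lemma branch_fixed_point_irr01:
  assumes "a \<noteq> []" "x \<in> {0..1}" "branch a x = x"
  shows "x \<in> irr01"
proof -
  have x0: "0 < x" using branch_pos[of x a] assms by auto
  have "x \<notin> \<rat>"
  proof
    assume "x \<in> \<rat>"
    then obtain m n where "n \<noteq> 0" "\<bar>x\<bar> = real m / real n"
      by (rule Rats_abs_nat_div_natE)
    then have ex: "\<exists>v. 0 < v \<and> (\<exists>u. x = real u / real v)" using x0 by auto
    \<comment> \<open>The least denominator of \<open>x\<close>. As the word leads from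
      \<open>x\<close> back to \<open>x\<close>, the descent would produce a smaller one.\<close>
    define v where "v = (LEAST v. 0 < v \<and> (\<exists>u. x = real u / real v))"
    obtain u where "0 < v" "x = real u / real v"
      using LeastI_ex[OF ex] unfolding v_def by blast
    then obtain u' v' where "0 < v'" "x = real u' / real v'" "v' < v"
      using branch_rational_descent[OF x0, of a u v] assms by auto
    then show False
      unfolding v_def using not_less_Least by blast
  qed
  moreover have "x \<noteq> 1" using \<open>x \<notin> \<rat>\<close> by auto
  ultimately show ?thesis using x0 assms(2) by (auto simp: irr01_def)
qed

text \<open>For a nonempty word the denominators exceed 1 on the positive reals, so the branch
  strictly contracts distances there.\<close>

lemma branch_fixed_point_unique:
  assumes "a \<noteq> []" "0 < x" "0 < y" "branch a x = x" "branch a y = y"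
  shows "x = y"
proof (rule ccontr)
  assume "x \<noteq> y"
  have gt: "1 < denom a z" if "0 < z" for z
  proof -
    obtain k b where a: "a = k # b" using assms(1) by (cases a) auto
    have "0 < branch b z" using that by (intro branch_pos) simp
    then have "1 < real k + 1 + branch b z" by simp
    also have "\<dots> \<le> denom b z * \<dots>"
      using denom_ge_1[of z b] that \<open>0 < branch b z\<close> by (simp add: mult_le_cancel_right1)
    finally show ?thesis by (simp add: a)
  qed
  have "1 < denom a x * denom a y" using gt assms(2,3) less_1_mult by blast
  then have "\<bar>x - y\<bar> / (denom a x * denom a y) < \<bar>x - y\<bar>"
    using \<open>x \<noteq> y\<close> by (simp add: divide_less_eq)
  then show False
    using branch_diff[of x y a] assms by simp
qed

lemma branch_fixed_point_exists:
  assumes "a \<noteq> []"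
  shows "\<exists>x. x \<in> irr01 \<and> branch a x = x"
proof -
  have cont: "continuous_on {0..1} (branch a)"
  proof (induction a)
    case (Cons k a)
    have "real k + 1 + branch a x \<noteq> 0" if "x \<in> {0..1}" for x
      using branch_nonneg[of x a] that by auto
    then show ?case using Cons by (auto intro!: continuous_intros)
  qed (simp add: id_def[symmetric])
  have "\<exists>x. 0 \<le> x \<and> x \<le> 1 \<and> branch a x - x = 0"
    using branch_mem[of 0 a] branch_mem[of 1 a]
    by (intro IVT2') (auto intro!: continuous_intros cont)
  then show ?thesis using branch_fixed_point_irr01[OF assms] by auto
qed

text \<open>The choice is determined for nonempty words; for the empty word every point is fixed and
  an arbitrary one is taken.\<close>

definition periodic_point :: "nat list \<Rightarrow> real" where
  "periodic_point a = (SOME x. x \<in> irr01 \<and> branch a x = x)"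

lemma periodic_point:
  assumes "a \<noteq> []"
  shows "periodic_point a \<in> irr01" "branch a (periodic_point a) = periodic_point a"
  using someI_ex[OF branch_fixed_point_exists[OF assms]] unfolding periodic_point_def by auto

text \<open>A point of \<open>Per n\<close> is fixed by the branch of its own first \<open>n\<close>
  digits, and these digits recover the word.\<close>

lemma bij_betw_periodic_point:
  assumes "0 < n"
  shows "bij_betw periodic_point {a. length a = n} (Per n)"
  unfolding bij_betw_def
proof
  have ne: "a \<noteq> []" if "length a = n" for a :: "nat list" using that assms by auto
  show "inj_on periodic_point {a. length a = n}"
  proof (rule inj_onI)
    fix a b assume ab: "a \<in> {a. length a = n}" "b \<in> {a. length a = n}"
      "periodic_point a = periodic_point b"
    then show "a = b"
      using periodic_point[OF ne, of a] periodic_point[OF ne, of b]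
      by (intro branch_eq_imp[of "periodic_point a" "periodic_point b"]) simp_all
  qed
  show "periodic_point ` {a. length a = n} = Per n"
  proof (intro equalityI subsetI)
    fix x assume "x \<in> periodic_point ` {a. length a = n}"
    then obtain a where a: "length a = n" "x = periodic_point a" by auto
    then show "x \<in> Per n"
      using periodic_point[OF ne[OF a(1)]] gauss_map_funpow_branch[of x a] by (simp add: Per_def)
  next
    fix x assume x: "x \<in> Per n"
    then have xi: "x \<in> irr01" "(gauss_map ^^ n) x = x" by (auto simp: Per_def)
    obtain a where a: "length a = n" "branch a x = x"
      using irr01_eq_branch[OF xi(1), of n] xi(2) by auto
    note p = periodic_point[OF ne[OF a(1)]]
    have "x = periodic_point a"
      by (rule branch_fixed_point_unique[OF ne[OF a(1)] _ _ a(2) p(2)])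
         (use irr01_bounds(1) xi(1) p(1) in auto)
    then show "x \<in> periodic_point ` {a. length a = n}" using a(1) by blast
  qed
qed

lemma per_weight_periodic_point:
  assumes "length a = n" "0 < n"
  shows "per_weight n (periodic_point a) = word_prob a (periodic_point a)"
proof -
  have ne: "a \<noteq> []" using assms by auto
  note p = periodic_point[OF ne]
  obtain D where "(gauss_map ^^ length a has_field_derivative D) (at (branch a (periodic_point a)))"
    "\<bar>D\<bar> = denom a (periodic_point a) ^ 2"
    using gauss_map_funpow_has_derivative[OF p(1)] by blast
  then show ?thesis
    using assms(1) p word_prob_fixed_point[of "periodic_point a" a] irr01_bounds(1)[OF p(1)]
    by (simp add: per_weight_def DERIV_imp_deriv inverse_eq_divide)
qed

section \<open>Invariance of the weights along periodic orbits\<close>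

lemma gauss_map_Per: "x \<in> Per n \<Longrightarrow> gauss_map x \<in> Per n"
  using gauss_map_irr01 by (auto simp: Per_def simp flip: funpow_swap1)

lemma bij_betw_gauss_map_Per:
  assumes "0 < n"
  shows "bij_betw gauss_map (Per n) (Per n)"
proof (rule bij_betwI[where g = "gauss_map ^^ (n - 1)"])
  have n: "n = Suc (n - 1)" using assms by simp
  have iter: "(gauss_map ^^ i) x \<in> Per n" if "x \<in> Per n" for x i
    using that by (induction i) (auto intro: gauss_map_Per)
  show "gauss_map \<in> Per n \<rightarrow> Per n" "gauss_map ^^ (n - 1) \<in> Per n \<rightarrow> Per n"
    using gauss_map_Per iter by auto
  fix x assume "x \<in> Per n"
  then have "(gauss_map ^^ Suc (n - 1)) x = x" using n by (simp add: Per_def)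
  then show "(gauss_map ^^ (n - 1)) (gauss_map x) = x" "gauss_map ((gauss_map ^^ (n - 1)) x) = x"
    by (simp_all add: funpow_swap1)
qed

text \<open>Differentiate \<open>T^n o T = T o T^n\<close> at \<open>x\<close>, with
  \<open>T\<close> the Gauss map. Since \<open>T^n x = x\<close>, both sides contain the nonzero
  factor \<open>T' x\<close>, which cancels.\<close>

lemma per_weight_gauss_map:
  assumes "x \<in> Per n"
  shows "per_weight n (gauss_map x) = per_weight n x"
proof -
  have x: "x \<in> irr01" "(gauss_map ^^ n) x = x" using assms by (auto simp: Per_def)
  have deriv: "\<exists>D. (gauss_map ^^ n has_field_derivative D) (at y)" if y: "y \<in> irr01" for y
  proof -
    obtain a where "length a = n" "y = branch a ((gauss_map ^^ n) y)"
      using irr01_eq_branch[OF y] by blast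
    then show ?thesis
      using gauss_map_funpow_has_derivative[OF gauss_iterate_irr01[OF y], of a n] by auto
  qed
  obtain D where D: "(gauss_map ^^ n has_field_derivative D) (at x)"
    using deriv[OF x(1)] by blast
  obtain E where E: "(gauss_map ^^ n has_field_derivative E) (at (gauss_map x))"
    using deriv[OF gauss_map_irr01[OF x(1)]] by blast
  note d = gauss_map_has_derivative[OF x(1)]
  have "((gauss_map ^^ n) \<circ> gauss_map has_field_derivative E * (- 1 / x ^ 2)) (at x)"
    by (rule DERIV_chain[OF E d])
  moreover have "(gauss_map \<circ> (gauss_map ^^ n) has_field_derivative (- 1 / x ^ 2) * D) (at x)"
    by (rule DERIV_chain[OF _ D]) (use x d in simp)
  ultimately have "E * (- 1 / x ^ 2) = (- 1 / x ^ 2) * D"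
    unfolding funpow.simps(2)[symmetric] funpow_Suc_right[symmetric] by (rule DERIV_unique)
  then have "E = D" using irr01_bounds(1)[OF x(1)] by simp
  then show ?thesis
    using D E by (simp add: per_weight_def DERIV_imp_deriv)
qed

section \<open>Convergence to the Gauss measure\<close>

definition gauss_density :: "real \<Rightarrow> real" where
  "gauss_density x = indicator {0..1} x / (ln 2 * (1 + x))"

text \<open>The Gauss measure as a distribution on the whole line, where distribution functions and
  Skorohod's theorem are available.\<close>

definition gauss_dist :: "real measure" where
  "gauss_dist = density lborel (\<lambda>x. ennreal (gauss_density x))"

lemma gauss_density_measurable [measurable]: "gauss_density \<in> borel_measurable borel"
  unfolding gauss_density_def by measurable

lemma gauss_density_nonneg: "0 \<le> gauss_density x"
  by (auto simp: gauss_density_def indicator_def)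

lemma gauss_density_le_2: "gauss_density x \<le> 2"
proof (cases "x \<in> {0..1}")
  case True
  have "1 / 2 * 1 \<le> ln 2 * (1 + x)"
    using ln2_ge_two_thirds True by (intro mult_mono) auto
  then show ?thesis using True by (simp add: gauss_density_def divide_le_eq)
qed (simp add: gauss_density_def)

lemma gauss_dist_prob: "emeasure gauss_dist UNIV = 1"
proof -
  have "emeasure gauss_dist UNIV =
      (\<integral>\<^sup>+x. ennreal (1 / (ln 2 * (1 + x))) * indicator {0..1} x \<partial>lborel)"
    unfolding gauss_dist_def
    by (subst emeasure_density)
       (auto intro!: nn_integral_cong simp: gauss_density_def split: split_indicator)
  also have "\<dots> = ennreal (ln (1 + 1) / ln 2 - ln (1 + 0) / ln 2)"
    by (rule nn_integral_FTC_Icc[where F = "\<lambda>x. ln (1 + x) / ln 2"])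
       (auto intro!: derivative_eq_intros simp: divide_simps)
  finally show ?thesis by simp
qed

interpretation gauss_dist: real_distribution gauss_dist
  by (intro real_distribution.intro real_distribution_axioms.intro prob_spaceI)
     (use gauss_dist_prob in \<open>simp_all add: gauss_dist_def\<close>)

lemma AE_gauss_dist: "AE x in gauss_dist. x \<in> {0..1}"
  unfolding gauss_dist_def
  by (subst AE_density) (auto intro!: AE_I2 simp: gauss_density_def indicator_def split: if_splits)

text \<open>Bounds the cost of moving the endpoints of an interval; the constant is the bound on the
  density.\<close>

lemma cdf_gauss_dist_lipschitz:
  assumes "s \<le> t"
  shows "cdf gauss_dist t - cdf gauss_dist s \<le> 2 * (t - s)"
proof (cases "s < t")
  case True
  have "emeasure gauss_dist {s<..t} \<le> (\<integral>\<^sup>+x. ennreal 2 * indicator {s<..t} x \<partial>lborel)"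
    unfolding gauss_dist_def
    by (subst emeasure_density) (simp, simp, intro nn_integral_mono mult_right_mono ennreal_leI
        gauss_density_le_2, simp)
  also have "\<dots> = ennreal 2 * ennreal (t - s)"
    using True by (subst nn_integral_cmult_indicator) auto
  also have "\<dots> = ennreal (2 * (t - s))"
    using assms by (intro ennreal_mult[symmetric]) auto
  finally have "measure gauss_dist {s<..t} \<le> 2 * (t - s)"
    using assms unfolding gauss_dist.emeasure_eq_measure by (subst (asm) ennreal_le_iff) auto
  then show ?thesis using gauss_dist.cdf_diff_eq[OF True] by simp
qed (use assms in simp)

lemma cdf_gauss_dist_0: "cdf gauss_dist 0 = 0"
proof -
  have "emeasure gauss_dist {..0} = 0"
    unfolding gauss_dist_def
  proof (subst emeasure_density)
    have "AE x in lborel. x \<noteq> (0::real)" by (rule AE_lborel_singleton)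
    then have "(\<integral>\<^sup>+x. ennreal (gauss_density x) * indicator {..0} x \<partial>lborel)
        = (\<integral>\<^sup>+x. 0 \<partial>(lborel :: real measure))"
      by (intro nn_integral_cong_AE) (auto simp: gauss_density_def split: split_indicator)
    then show "(\<integral>\<^sup>+x. ennreal (gauss_density x) * indicator {..0} x \<partial>lborel) = 0" by simp
  qed auto
  then show ?thesis by (simp add: cdf_def measure_def)
qed

lemma cdf_gauss_dist_1: "cdf gauss_dist 1 = 1"
proof -
  have "AE x in gauss_dist. x \<in> {..1}" using AE_gauss_dist by eventually_elim simp
  then show ?thesis by (simp add: cdf_def gauss_dist.prob_eq_1)
qed

section \<open>Invariance of the Gauss measure and the Gauss-Kuzmin theorem\<close>

lemma gauss_op_measurable [measurable]:
  assumes [measurable]: "f \<in> borel_measurable borel"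
  shows "gauss_op f \<in> borel_measurable borel"
  unfolding gauss_op_def[abs_def] gauss_prob_def by measurable

text \<open>The substitution \<open>z = 1 / (k + 1 + y)\<close>, reflected to be increasing.\<close>

lemma gauss_prob_substitution:
  fixes f :: "real \<Rightarrow> real"
  assumes [measurable]: "f \<in> borel_measurable borel" and f: "f \<in> {0..1} \<rightarrow> {0..1}"
  shows "(\<integral>\<^sup>+y. ennreal (gauss_prob k y * f (1 / (real k + 1 + y)) * gauss_density y) \<partial>lborel) =
    (\<integral>\<^sup>+z. ennreal (f z * gauss_density z) * indicator {1 / (real k + 2)..1 / (real k + 1)} z
      \<partial>lborel)"
proof -
  define g where "g u = 1 / (real k + 2 - u)" for u :: real
  define g' where "g' u = 1 / (real k + 2 - u) ^ 2" for u :: real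
  let ?h = "\<lambda>y. ennreal (gauss_prob k y * f (1 / (real k + 1 + y)) * gauss_density y)"
  have g01: "g 0 = 1 / (real k + 2)" "g 1 = 1 / (real k + 1)" by (simp_all add: g_def)
  have "(\<integral>\<^sup>+z. ennreal (f z * gauss_density z) * indicator {g 0..g 1} z \<partial>lborel) =
      (\<integral>\<^sup>+u. ennreal (f (g u) * gauss_density (g u) * g' u) * indicator {0..1} u \<partial>lborel)"
    unfolding nn_integral_set_ennreal
  proof (subst nn_integral_substitution[where g = g and g' = g', unfolded nn_integral_set_ennreal])
    show "set_borel_measurable borel {g 0..g 1} (\<lambda>z. f z * gauss_density z)"
      unfolding set_borel_measurable_def by measurable
    show "(g has_real_derivative g' x) (at x)" if "x \<in> {0..1}" for x
      unfolding g_def g'_def using that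
      by (auto intro!: derivative_eq_intros simp: power2_eq_square)
    show "continuous_on {0..1} g'"
      unfolding g'_def by (auto intro!: continuous_intros)
    show "0 \<le> g' x" for x by (simp add: g'_def)
  qed auto
  also have "\<dots> = (\<integral>\<^sup>+u. ?h (1 + (- 1) * u) \<partial>lborel)"
  proof (intro nn_integral_cong)
    fix u :: real
    show "ennreal (f (g u) * gauss_density (g u) * g' u) * indicator {0..1} u = ?h (1 + (- 1) * u)"
    proof (cases "u \<in> {0..1}")
      case True
      define w where "w = real k + 2 - u"
      have w: "1 \<le> w" using True by (simp add: w_def)
      have "g u \<in> {0..1}" using True by (auto simp: g_def divide_simps)
      then have "gauss_density (g u) * g' u = 1 / (ln 2 * (1 + 1 / w)) / w ^ 2"
        by (simp add: gauss_density_def g_def g'_def flip: w_def)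
      also have "\<dots> = 1 / (ln 2 * (w * (w + 1)))"
        using w by (simp add: divide_simps power2_eq_square)
      also have "\<dots> = gauss_prob k (1 - u) * gauss_density (1 - u)"
      proof -
        have "1 + (1 - u) = 2 - u" "real k + 1 + (1 - u) = w" "real k + 2 + (1 - u) = w + 1"
          by (simp_all add: w_def)
        then have "gauss_prob k (1 - u) = (2 - u) / (w * (w + 1))"
          by (simp only: gauss_prob_def)
        moreover have "gauss_density (1 - u) = 1 / (ln 2 * (2 - u))" "2 - u \<noteq> 0"
          using True by (auto simp: gauss_density_def)
        ultimately show ?thesis by simp
      qed
      finally have eq: "gauss_density (g u) * g' u = gauss_prob k (1 - u) * gauss_density (1 - u)" .
      have "real k + 1 + (1 - u) = real k + 2 - u" by simp
      then have "f (g u) * gauss_density (g u) * g' u =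
          gauss_prob k (1 - u) * f (1 / (real k + 1 + (1 - u))) * gauss_density (1 - u)"
        unfolding mult.assoc eq by (simp only: g_def mult_ac)
      then show ?thesis using True by simp
    qed (auto simp: gauss_density_def)
  qed
  also have "\<dots> = (\<integral>\<^sup>+y. ?h y \<partial>lborel)"
    by (subst nn_integral_real_affine[where c = "-1" and t = 1]) (simp_all add: gauss_prob_def)
  finally show ?thesis unfolding g01 by simp
qed

text \<open>The \<open>k\<close>-th interval is the set of points whose first digit, the floor of
  the reciprocal, is \<open>k + 1\<close>.\<close>

lemma UN_inverse_nat_intervals:
  "(\<Union>k. {1 / (real k + 2)<..1 / (real k + 1)}) = {0<..1}"
proof (intro equalityI subsetI)
  fix z :: real assume z: "z \<in> {0<..1}"
  define k where "k = nat (\<lfloor>1 / z\<rfloor> - 1)"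
  have "1 \<le> 1 / z" using z by simp
  then have "real k + 1 = of_int \<lfloor>1 / z\<rfloor>" by (simp add: k_def le_floor_iff)
  then have "real k + 1 \<le> 1 / z" "1 / z < real k + 2" by linarith+
  then have "z \<in> {1 / (real k + 2)<..1 / (real k + 1)}"
    using z by (simp add: field_simps)
  then show "z \<in> (\<Union>k. {1 / (real k + 2)<..1 / (real k + 1)})" by blast
next
  fix z :: real assume "z \<in> (\<Union>k. {1 / (real k + 2)<..1 / (real k + 1)})"
  then obtain k where k: "1 / (real k + 2) < z" "z \<le> 1 / (real k + 1)" by auto
  have "0 < 1 / (real k + 2)" "1 / (real k + 1) \<le> 1" by simp_all
  then show "z \<in> {0<..1}" using k by (simp only: greaterThanAtMost_iff) linarith
qed

lemma disjoint_inverse_nat_intervals: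
  "disjoint_family (\<lambda>k. {1 / (real k + 2)<..1 / (real k + 1)})"
proof -
  have "{1 / (real k + 2)<..1 / (real k + 1)} \<inter> {1 / (real l + 2)<..1 / (real l + 1)} = {}"
    if "k < l" for k l :: nat
  proof -
    have "1 / (real l + 1) \<le> 1 / (real k + 2)"
      using that by (intro divide_left_mono) auto
    then show ?thesis by auto
  qed
  then show ?thesis
    unfolding disjoint_family_on_def by (metis Int_commute nat_neq_iff)
qed

text \<open>The integral of the \<open>k\<close>-th term of the operator is the integral of
  \<open>f\<close> over the \<open>k\<close>-th digit interval, and these intervals partition
  \<open>{0<..1}\<close>.\<close>

lemma gauss_op_invariant:
  fixes f :: "real \<Rightarrow> real"
  assumes [measurable]: "f \<in> borel_measurable borel" and f: "f \<in> {0..1} \<rightarrow> {0..1}"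
  shows "(\<integral>\<^sup>+y. ennreal (gauss_op f y) \<partial>gauss_dist) = (\<integral>\<^sup>+y. ennreal (f y) \<partial>gauss_dist)"
proof -
  define M where "M = density lborel (\<lambda>z. ennreal (f z * gauss_density z))"
  let ?I = "\<lambda>k. {1 / (real k + 2)<..1 / (real k + 1)}"
  have [measurable]: "gauss_prob k \<in> borel_measurable borel" for k
    unfolding gauss_prob_def[abs_def] by measurable
  have fnn: "0 \<le> f (1 / (real k + 1 + y))" if "y \<in> {0..1}" for k y
    using inverse_digit_mem[of y k] f that by (auto simp: Pi_iff)
  have expand: "ennreal (gauss_density y) * ennreal (gauss_op f y) =
      (\<Sum>k. ennreal (gauss_prob k y * f (1 / (real k + 1 + y)) * gauss_density y))" for y
  proof (cases "y \<in> {0..1}")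
    case True
    have "(\<Sum>k. ennreal (gauss_prob k y * f (1 / (real k + 1 + y)) * gauss_density y)) =
        ennreal (\<Sum>k. gauss_prob k y * f (1 / (real k + 1 + y)) * gauss_density y)"
      using True fnn gauss_prob_nonneg gauss_density_nonneg gauss_op_summable[OF _ f, of y]
      by (intro suminf_ennreal2 mult_nonneg_nonneg summable_mult2) auto
    also have "\<dots> = ennreal (gauss_op f y * gauss_density y)"
      unfolding gauss_op_def using True gauss_op_summable[OF _ f, of y]
      by (subst suminf_mult2) auto
    also have "\<dots> = ennreal (gauss_density y) * ennreal (gauss_op f y)"
      by (subst mult.commute) (rule ennreal_mult'[OF gauss_density_nonneg])
    finally show ?thesis by (rule sym)
  qed (simp add: gauss_density_def)
  have "(\<integral>\<^sup>+y. ennreal (gauss_op f y) \<partial>gauss_dist) =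
      (\<integral>\<^sup>+y. ennreal (gauss_density y) * ennreal (gauss_op f y) \<partial>lborel)"
    unfolding gauss_dist_def by (subst nn_integral_density) auto
  also have "\<dots> = (\<Sum>k. \<integral>\<^sup>+y. ennreal (gauss_prob k y * f (1 / (real k + 1 + y)) * gauss_density y)
      \<partial>lborel)"
    unfolding expand by (rule nn_integral_suminf) measurable
  also have "\<dots> = (\<Sum>k. emeasure M (?I k))"
  proof (intro arg_cong[where f = suminf] ext)
    fix k
    have "AE z in lborel. z \<noteq> 1 / (real k + 2)" by (rule AE_lborel_singleton)
    then show "(\<integral>\<^sup>+y. ennreal (gauss_prob k y * f (1 / (real k + 1 + y)) * gauss_density y) \<partial>lborel)
        = emeasure M (?I k)"
      unfolding gauss_prob_substitution[OF assms] M_def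
      by (subst emeasure_density) (auto intro!: nn_integral_cong_AE split: split_indicator)
  qed
  also have "\<dots> = emeasure M {0<..1}"
    using disjoint_inverse_nat_intervals
    by (subst suminf_emeasure) (auto simp: M_def UN_inverse_nat_intervals)
  also have "\<dots> = (\<integral>\<^sup>+y. ennreal (gauss_density y) * ennreal (f y) \<partial>lborel)"
  proof -
    have "AE z in lborel. z \<noteq> (0::real)" by (rule AE_lborel_singleton)
    moreover have "ennreal (f z * gauss_density z) * indicator {0<..1} z =
        ennreal (gauss_density z) * ennreal (f z)" if "z \<noteq> 0" for z
    proof (cases "z \<in> {0<..1}")
      case True
      then show ?thesis by (simp add: mult.commute[of "f z"] ennreal_mult'[OF gauss_density_nonneg])
    next
      case False
      then have "gauss_density z = 0" using that by (auto simp: gauss_density_def)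
      then show ?thesis by simp
    qed
    ultimately show ?thesis
      unfolding M_def by (subst emeasure_density) (auto intro!: nn_integral_cong_AE)
  qed
  also have "\<dots> = (\<integral>\<^sup>+y. ennreal (f y) \<partial>gauss_dist)"
    unfolding gauss_dist_def by (subst nn_integral_density) auto
  finally show ?thesis .
qed

text \<open>This is the Gauss-Kuzmin theorem.\<close>

lemma gauss_op_iterate_indicator:
  assumes y: "y \<in> {0..1}"
  shows "\<bar>(gauss_op ^^ n) (indicator {..t}) y - cdf gauss_dist t\<bar> \<le> 1 / 2 ^ n"
proof -
  let ?f = "indicator {..t} :: real \<Rightarrow> real"
  let ?V = "\<lambda>n. (gauss_op ^^ n) ?f"
  have mf: "monotone_fraction ?f"
    by (auto simp: monotone_fraction_def monotone_on_def split: split_indicator)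
  note osc = gauss_op_iterate_oscillation[OF mf]
  have meas [measurable]: "?V n \<in> borel_measurable borel" for n
    by (induction n) auto
  have range: "?V n \<in> {0..1} \<rightarrow> {0..1}" for n
    using osc(1)[of n] by (simp add: monotone_fraction_def)
  have "(\<integral>\<^sup>+x. ennreal (?V n x) \<partial>gauss_dist) = (\<integral>\<^sup>+x. ennreal (?f x) \<partial>gauss_dist)"
  proof (induction n)
    case (Suc n)
    then show ?case using gauss_op_invariant[OF meas range, of n] by simp
  qed simp
  also have "\<dots> = emeasure gauss_dist {..t}"
    by (subst nn_integral_indicator[symmetric]) (auto simp: ennreal_indicator)
  finally have nn: "(\<integral>\<^sup>+x. ennreal (?V n x) \<partial>gauss_dist) = ennreal (cdf gauss_dist t)"
    by (simp add: gauss_dist.emeasure_eq_measure cdf_def)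
  have V01: "AE x in gauss_dist. ?V n x \<in> {0..1}"
    using AE_gauss_dist by eventually_elim (use range in blast)
  have int: "integrable gauss_dist (?V n)"
    by (rule gauss_dist.integrable_const_bound[where B = 1]) (use V01 in auto)
  have "(\<integral>x. ?V n x \<partial>gauss_dist) = cdf gauss_dist t"
    using nn V01 gauss_dist.cdf_nonneg[of t] by (subst integral_eq_nn_integral) auto
  \<comment> \<open>By invariance all iterates have mean \<open>cdf gauss_dist t\<close>; a function
    whose values differ by at most \<open>1 / 2 ^ n\<close> stays that close to its mean.\<close>
  moreover have "AE x in gauss_dist. \<bar>?V n x - ?V n y\<bar> \<le> 1 / 2 ^ n"
    using AE_gauss_dist by eventually_elim (use osc(2) y in blast)
  then have "AE x in gauss_dist. ?V n x \<le> ?V n y + 1 / 2 ^ n"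
    "AE x in gauss_dist. ?V n y - 1 / 2 ^ n \<le> ?V n x"
    by (eventually_elim, linarith)+
  then have "(\<integral>x. ?V n x \<partial>gauss_dist) \<le> ?V n y + 1 / 2 ^ n"
    "?V n y - 1 / 2 ^ n \<le> (\<integral>x. ?V n x \<partial>gauss_dist)"
    using int gauss_dist.integral_le_const gauss_dist.integral_ge_const by blast+
  ultimately show ?thesis by linarith
qed

section \<open>Asymptotic distribution of the weighted periodic points\<close>

definition point_weight :: "nat list \<Rightarrow> real" where
  "point_weight a = word_prob a (periodic_point a)"

text \<open>The unnormalised distribution function of the weights on \<open>Per n\<close>, indexed
  by words instead of points.\<close>

definition per_mass :: "nat \<Rightarrow> real \<Rightarrow> real" where
  "per_mass n t = (\<Sum>\<^sub>\<infinity>a | length a = n. point_weight a * indicator {..t} (periodic_point a))"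

lemma point_weight_pos:
  assumes "a \<noteq> []"
  shows "0 < point_weight a"
proof -
  have p: "0 < periodic_point a" by (rule irr01_bounds(1)[OF periodic_point(1)[OF assms]])
  then show ?thesis
    using branch_nonneg[of "periodic_point a" a] denom_ge_1[of "periodic_point a" a]
    by (simp add: point_weight_def word_prob_def zero_less_power)
qed

text \<open>Distortion compares the weights with the transition probabilities from 0, whose sum is
  1. The distance to 0 plus \<open>1 / real n ^ 2\<close> is at most 2, hence the factor
  \<open>(1 + 2) ^ 3\<close>.\<close>

lemma point_weight_summable:
  assumes "0 < n"
  shows "point_weight summable_on {a. length a = n}"
proof (rule summable_on_comparison_test)
  have "((\<lambda>a. word_prob a 0 * 1) has_sum (gauss_op ^^ n) (\<lambda>_. 1) 0) {a. length a = n}"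
    by (rule gauss_op_iterate_has_sum) auto
  then show "(\<lambda>a. (1 + 2) ^ 3 * word_prob a 0) summable_on {a. length a = n}"
    by (intro summable_on_cmult_right) (auto simp: summable_on_def)
  fix a :: "nat list" assume a: "a \<in> {a. length a = n}"
  then have ne: "a \<noteq> []" using assms by auto
  note p = periodic_point[OF ne]
  have "1 / real n ^ 2 \<le> 1" using assms by simp
  moreover have "\<bar>periodic_point a - 0\<bar> \<le> 1" using irr01_bounds[OF p(1)] by simp
  ultimately have d: "\<bar>periodic_point a - 0\<bar> + 1 / real n ^ 2 \<le> 2" by linarith
  show "point_weight a \<le> (1 + 2) ^ 3 * word_prob a 0"
    unfolding point_weight_def
    by (rule word_prob_distortion(1)[OF irr01_bounds(3)[OF p(1)] _ p(2) _ assms d]) (use a in auto)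
  show "0 \<le> point_weight a" using point_weight_pos[OF ne] by simp
qed

lemma per_mass_has_sum:
  assumes "0 < n"
  shows "((\<lambda>a. point_weight a * indicator {..t} (periodic_point a)) has_sum per_mass n t)
    {a. length a = n}"
  unfolding per_mass_def
proof (rule has_sum_infsum, rule summable_on_comparison_test[OF point_weight_summable[OF assms]])
  fix a :: "nat list" assume "a \<in> {a. length a = n}"
  then have "0 < point_weight a" using assms by (intro point_weight_pos) auto
  then show "point_weight a * indicator {..t} (periodic_point a) \<le> point_weight a"
    "0 \<le> point_weight a * indicator {..t} (periodic_point a)"
    by (auto split: split_indicator)
qed

lemma per_mass_nonneg:
  assumes "0 < n"
  shows "0 \<le> per_mass n t"
proof (rule has_sum_nonneg[OF per_mass_has_sum[OF assms]])
  fix a :: "nat list" assume "a \<in> {a. length a = n}"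
  then have "0 < point_weight a" using assms by (intro point_weight_pos) auto
  then show "0 \<le> point_weight a * indicator {..t} (periodic_point a)" by simp
qed

lemma has_sum_diff:
  fixes f g :: "'a \<Rightarrow> 'b :: topological_ab_group_add"
  assumes "(f has_sum a) A" "(g has_sum b) A"
  shows "((\<lambda>x. f x - g x) has_sum (a - b)) A"
  using has_sum_add[OF assms(1), of "\<lambda>x. - g x" "- b"] assms(2) by (simp add: has_sum_uminus)

text \<open>Over a short interval the weights, taken at the periodic points, may be replaced by the
  transition probabilities from \<open>t\<close>; the inverse branches from \<open>t\<close> land within
  \<open>1 / n\<^sup>2\<close> of the corresponding periodic points.\<close>

lemma per_mass_increment:
  assumes st: "0 \<le> s" "s \<le> t" "t \<le> 1" and n: "0 < n"
    and d: "t - s + 1 / real n ^ 2 \<le> d"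
  defines "e \<equiv> 4 / real n ^ 2 + 2 / 2 ^ n"
  shows "per_mass n t - per_mass n s \<le> (1 + d) ^ 3 * (cdf gauss_dist t - cdf gauss_dist s + e)"
    and "cdf gauss_dist t - cdf gauss_dist s - e \<le> (1 + d) ^ 3 * (per_mass n t - per_mass n s)"
proof -
  \<comment> \<open>The bound for the distance between \<open>branch a t\<close> and the periodic
    point of \<open>a\<close>.\<close>
  define \<epsilon> where "\<epsilon> = 1 / real n ^ 2"
  have \<epsilon>: "0 \<le> \<epsilon>" by (simp add: \<epsilon>_def)
  have d0: "0 \<le> d" using d st \<epsilon> unfolding \<epsilon>_def by linarith
  define V where "V u = (gauss_op ^^ n) (indicator {..u}) t" for u
  have t01: "t \<in> {0..1}" using st by auto
  have V: "((\<lambda>a. word_prob a t * (indicator {..u} (branch a t) - indicator {..v} (branch a t)))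
      has_sum (V u - V v)) {a. length a = n}" for u v :: real
    unfolding V_def right_diff_distrib
    by (intro has_sum_diff gauss_op_iterate_has_sum t01) (auto split: split_indicator)
  have F: "((\<lambda>a. point_weight a * (indicator {..t} (periodic_point a) - indicator {..s} (periodic_point a)))
      has_sum (per_mass n t - per_mass n s)) {a. length a = n}"
    unfolding right_diff_distrib by (intro has_sum_diff per_mass_has_sum n)
  have VG: "\<bar>V u - cdf gauss_dist u\<bar> \<le> 1 / 2 ^ n" for u
    unfolding V_def by (rule gauss_op_iterate_indicator[OF t01])
  have G: "cdf gauss_dist v - cdf gauss_dist u \<le> 2 * \<epsilon>" if "v = u + \<epsilon>" for u v
    using cdf_gauss_dist_lipschitz[of u v] that \<epsilon> by simp
  \<comment> \<open>Moving two endpoints by \<open>\<epsilon>\<close> costs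
    \<open>2 * \<epsilon>\<close> each; the Gauss-Kuzmin error \<open>1 / 2 ^ n\<close> occurs at
    both endpoints.\<close>
  have e: "e = 4 * \<epsilon> + 2 * (1 / 2 ^ n)" by (simp add: e_def \<epsilon>_def)
  have word: "0 \<le> point_weight a" "0 \<le> word_prob a t"
    "\<bar>branch a t - periodic_point a\<bar> \<le> \<epsilon>"
    "s < periodic_point a \<Longrightarrow> periodic_point a \<le> t \<Longrightarrow>
      point_weight a \<le> (1 + d) ^ 3 * word_prob a t"
    "s < periodic_point a \<Longrightarrow> periodic_point a \<le> t \<Longrightarrow>
      word_prob a t \<le> (1 + d) ^ 3 * point_weight a"
    if a: "a \<in> {a. length a = n}" for a
  proof -
    have ne: "a \<noteq> []" using a n by auto
    note p = periodic_point[OF ne]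
    show "0 \<le> point_weight a" using point_weight_pos[OF ne] by simp
    show "0 \<le> word_prob a t" using st by (intro word_prob_nonneg) simp
    have "\<bar>branch a t - branch a (periodic_point a)\<bar> \<le> 1 / real n ^ 2"
      using a n by (intro branch_contract t01 irr01_bounds(3) p) auto
    then show "\<bar>branch a t - periodic_point a\<bar> \<le> \<epsilon>"
      unfolding p(2) \<epsilon>_def .
    assume "s < periodic_point a" "periodic_point a \<le> t"
    then have "\<bar>periodic_point a - t\<bar> + 1 / real n ^ 2 \<le> d" using d by linarith
    from word_prob_distortion[OF irr01_bounds(3)[OF p(1)] t01 p(2) _ n this] a
    show "point_weight a \<le> (1 + d) ^ 3 * word_prob a t" "word_prob a t \<le> (1 + d) ^ 3 * point_weight a"
      unfolding point_weight_def by auto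
  qed
  have K: "0 \<le> (1 + d) ^ 3" using d0 by simp
  \<comment> \<open>The interval is enlarged by \<open>\<epsilon>\<close> on both sides, so that it
    contains \<open>branch a t\<close> whenever the periodic point lies in \<open>{s<..t}\<close>.
    The lower bound shrinks it instead.\<close>
  have "per_mass n t - per_mass n s \<le> (1 + d) ^ 3 * (V (t + \<epsilon>) - V (s - \<epsilon>))"
  proof (rule has_sum_mono[OF F has_sum_cmult_right[OF V]])
    fix a assume a: "a \<in> {a::nat list. length a = n}"
    note w = word[OF a]
    let ?r = "(1 + d) ^ 3 * (word_prob a t *
      (indicator {..t + \<epsilon>} (branch a t) - indicator {..s - \<epsilon>} (branch a t)))"
    show "point_weight a * (indicator {..t} (periodic_point a) - indicator {..s} (periodic_point a)) \<le> ?r"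
    proof (cases "s < periodic_point a \<and> periodic_point a \<le> t")
      case True
      then have "s - \<epsilon> < branch a t" "branch a t \<le> t + \<epsilon>" using w(3) by linarith+
      then show ?thesis using True w(4) by simp
    next
      case False
      then have "indicator {..t} (periodic_point a) - indicator {..s} (periodic_point a) = (0::real)"
        using st(2) by (auto split: split_indicator)
      moreover have "(0::real) \<le> indicator {..t + \<epsilon>} (branch a t) - indicator {..s - \<epsilon>} (branch a t)"
        using st(2) \<epsilon> by (auto split: split_indicator)
      then have "0 \<le> ?r" by (intro mult_nonneg_nonneg K w(2))
      ultimately show ?thesis by simp
    qed
  qed
  also have "V (t + \<epsilon>) - V (s - \<epsilon>) \<le> cdf gauss_dist t - cdf gauss_dist s + e"
    using VG[of "t + \<epsilon>"] VG[of "s - \<epsilon>"] G[of "t + \<epsilon>" t, OF refl] G[of s "s - \<epsilon>"]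
    unfolding e by simp
  finally show "per_mass n t - per_mass n s \<le> (1 + d) ^ 3 * (cdf gauss_dist t - cdf gauss_dist s + e)"
    using K by (simp add: mult_left_mono)
  have "cdf gauss_dist t - cdf gauss_dist s - e \<le> V (t - \<epsilon>) - V (s + \<epsilon>)"
    using VG[of "t - \<epsilon>"] VG[of "s + \<epsilon>"] G[of t "t - \<epsilon>"] G[of "s + \<epsilon>" s, OF refl]
    unfolding e by simp
  also have "\<dots> \<le> (1 + d) ^ 3 * (per_mass n t - per_mass n s)"
  proof (rule has_sum_mono[OF V has_sum_cmult_right[OF F]])
    fix a assume a: "a \<in> {a::nat list. length a = n}"
    note w = word[OF a]
    let ?i = "indicator {..t - \<epsilon>} (branch a t) - indicator {..s + \<epsilon>} (branch a t) :: real"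
    let ?j = "indicator {..t} (periodic_point a) - indicator {..s} (periodic_point a) :: real"
    have j0: "0 \<le> (1 + d) ^ 3 * (point_weight a * ?j)"
      using st(2) by (intro mult_nonneg_nonneg K w(1)) (auto split: split_indicator)
    show "word_prob a t * ?i \<le> (1 + d) ^ 3 * (point_weight a * ?j)"
    proof (cases "s + \<epsilon> < branch a t \<and> branch a t \<le> t - \<epsilon>")
      case True
      then have "s < periodic_point a" "periodic_point a \<le> t" using w(3) by linarith+
      then show ?thesis using True w(5) by simp
    next
      case False
      \<comment> \<open>Only an inequality: if \<open>t - s < 2 * \<epsilon>\<close>, the shrunk
        endpoints are in reverse order and the difference can be -1.\<close>
      then have "?i \<le> 0" by (auto split: split_indicator)
      then have "word_prob a t * ?i \<le> 0" by (intro mult_nonneg_nonpos w(2))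
      then show ?thesis using j0 by linarith
    qed
  qed
  finally show "cdf gauss_dist t - cdf gauss_dist s - e \<le> (1 + d) ^ 3 * (per_mass n t - per_mass n s)" .
qed

lemma per_mass_nonpos:
  assumes "0 < n" "t \<le> 0"
  shows "per_mass n t = 0"
proof -
  have "per_mass n t = (\<Sum>\<^sub>\<infinity>a\<in>{a :: nat list. length a = n}. 0)"
    unfolding per_mass_def
  proof (rule infsum_cong)
    fix a :: "nat list" assume "a \<in> {a. length a = n}"
    then have "periodic_point a \<in> irr01" using assms(1) by (intro periodic_point) auto
    then show "point_weight a * indicator {..t} (periodic_point a) = 0"
      using assms(2) by (auto simp: irr01_def split: split_indicator)
  qed
  then show ?thesis by simp
qed

lemma per_mass_ge_1:
  assumes "0 < n" "1 \<le> t"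
  shows "per_mass n t = per_mass n 1"
  unfolding per_mass_def
proof (rule infsum_cong)
  fix a :: "nat list" assume "a \<in> {a. length a = n}"
  then have "periodic_point a \<in> irr01" using assms(1) by (intro periodic_point) auto
  then show "point_weight a * indicator {..t} (periodic_point a) =
      point_weight a * indicator {..1} (periodic_point a)"
    using assms(2) by (auto simp: irr01_def split: split_indicator)
qed

text \<open>With \<open>n\<close> pieces of length \<open>t / real n\<close> the distortion
  parameter is at most \<open>2 / real n\<close>, while the \<open>n\<close> errors, each of order
  \<open>1 / real n ^ 2\<close>, still add up to something that vanishes.\<close>

lemma per_mass_bounds:
  assumes "t \<in> {0..1}" "0 < n"
  defines "e \<equiv> real n * (4 / real n ^ 2 + 2 / 2 ^ n)"
  shows "per_mass n t \<le> (1 + 2 / real n) ^ 3 * (cdf gauss_dist t + e)"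
    and "cdf gauss_dist t - e \<le> (1 + 2 / real n) ^ 3 * per_mass n t"
proof -
  define u where "u i = t * real i / real n" for i
  let ?e = "4 / real n ^ 2 + 2 / 2 ^ n"
  have u: "0 \<le> u i" "u i \<le> u (Suc i)" "u (Suc i) \<le> 1"
    "u (Suc i) - u i + 1 / real n ^ 2 \<le> 2 / real n" if "i < n" for i
  proof -
    show "0 \<le> u i" "u i \<le> u (Suc i)"
      using assms by (auto simp: u_def intro!: divide_right_mono mult_left_mono)
    have "t * real (Suc i) \<le> 1 * real n" using assms that by (intro mult_mono) auto
    then show "u (Suc i) \<le> 1" using assms by (simp add: u_def)
    have "u (Suc i) - u i = t / real n"
      unfolding u_def by (simp add: diff_divide_distrib[symmetric] algebra_simps)
    moreover have "t / real n \<le> 1 / real n" using assms by (intro divide_right_mono) auto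
    moreover have "1 / real n ^ 2 \<le> 1 / real n"
      using assms by (intro divide_left_mono) (auto simp: self_le_power)
    ultimately show "u (Suc i) - u i + 1 / real n ^ 2 \<le> 2 / real n" by simp
  qed
  have u0: "u 0 = 0" and un: "u n = t" using assms by (auto simp: u_def)
  have F: "per_mass n t = (\<Sum>i<n. per_mass n (u (Suc i)) - per_mass n (u i))"
    using assms sum_lessThan_telescope[of "\<lambda>i. per_mass n (u i)" n]
    by (simp add: u0 un per_mass_nonpos)
  have G: "cdf gauss_dist t = (\<Sum>i<n. cdf gauss_dist (u (Suc i)) - cdf gauss_dist (u i))"
    using sum_lessThan_telescope[of "\<lambda>i. cdf gauss_dist (u i)" n]
    by (simp add: u0 un cdf_gauss_dist_0)
  note inc = per_mass_increment[OF u(1) u(2) u(3) assms(2) u(4)]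
  have "per_mass n t \<le> (\<Sum>i<n. (1 + 2 / real n) ^ 3 *
      (cdf gauss_dist (u (Suc i)) - cdf gauss_dist (u i) + ?e))"
    unfolding F by (intro sum_mono inc) auto
  also have "\<dots> = (1 + 2 / real n) ^ 3 * (cdf gauss_dist t + e)"
    unfolding G e_def by (simp add: sum.distrib flip: sum_distrib_left)
  finally show "per_mass n t \<le> (1 + 2 / real n) ^ 3 * (cdf gauss_dist t + e)" .
  have "cdf gauss_dist t - e =
      (\<Sum>i<n. cdf gauss_dist (u (Suc i)) - cdf gauss_dist (u i) - ?e)"
    unfolding G e_def by (simp add: sum_subtractf)
  also have "\<dots> \<le> (\<Sum>i<n. (1 + 2 / real n) ^ 3 * (per_mass n (u (Suc i)) - per_mass n (u i)))"
    by (intro sum_mono inc) auto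
  also have "\<dots> = (1 + 2 / real n) ^ 3 * per_mass n t"
    unfolding F by (simp add: sum_distrib_left)
  finally show "cdf gauss_dist t - e \<le> (1 + 2 / real n) ^ 3 * per_mass n t" .
qed

lemma per_mass_tendsto:
  assumes "t \<in> {0..1}"
  shows "(\<lambda>n. per_mass n t) \<longlonglongrightarrow> cdf gauss_dist t"
proof -
  let ?K = "\<lambda>n. (1 + 2 / real n) ^ 3"
  let ?e = "\<lambda>n. real n * (4 / real n ^ 2 + 2 / 2 ^ n)"
  have inv: "(\<lambda>n. c * (1 / real n)) \<longlonglongrightarrow> 0" for c :: real
    using tendsto_mult[OF tendsto_const lim_1_over_n, of c] by simp
  have "(\<lambda>n. (1 + 2 * (1 / real n)) ^ 3) \<longlonglongrightarrow> (1 + 0) ^ 3"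
    by (rule tendsto_power[OF tendsto_add[OF tendsto_const inv]])
  then have K: "?K \<longlonglongrightarrow> 1" by simp
  have "(\<lambda>n. real n / 2 ^ n) \<longlonglongrightarrow> 0"
    by (rule lim_n_over_pown) simp
  then have "(\<lambda>n. 4 * (1 / real n) + 2 * (real n / 2 ^ n)) \<longlonglongrightarrow> 0 + 2 * 0"
    by (rule tendsto_add[OF inv tendsto_mult[OF tendsto_const]])
  moreover have "4 * (1 / real n) + 2 * (real n / 2 ^ n) = ?e n" for n
    by (cases "n = 0") (simp_all add: distrib_left power2_eq_square)
  ultimately have e: "?e \<longlonglongrightarrow> 0" by simp
  have lower: "(\<lambda>n. (cdf gauss_dist t - ?e n) / ?K n) \<longlonglongrightarrow> (cdf gauss_dist t - 0) / 1"
    by (rule tendsto_divide[OF tendsto_diff[OF tendsto_const e] K]) simp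
  have upper: "(\<lambda>n. ?K n * (cdf gauss_dist t + ?e n)) \<longlonglongrightarrow> 1 * (cdf gauss_dist t + 0)"
    by (rule tendsto_mult[OF K tendsto_add[OF tendsto_const e]])
  have "(cdf gauss_dist t - ?e n) / ?K n \<le> per_mass n t" if "0 < n" for n
  proof -
    have "0 < ?K n" by (intro zero_less_power add_pos_nonneg) auto
    then show ?thesis
      using per_mass_bounds(2)[OF assms that]
      by (subst pos_divide_le_eq) (auto simp only: mult.commute)
  qed
  then have L: "\<forall>\<^sub>F n in sequentially. (cdf gauss_dist t - ?e n) / ?K n \<le> per_mass n t"
    by (rule eventually_sequentiallyI[of 1]) simp
  have U: "\<forall>\<^sub>F n in sequentially. per_mass n t \<le> ?K n * (cdf gauss_dist t + ?e n)"
    by (rule eventually_sequentiallyI[of 1]) (rule per_mass_bounds(1)[OF assms], simp)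
  show ?thesis
    using tendsto_sandwich[OF L U, of "cdf gauss_dist t"] lower upper by simp
qed

text \<open>The total mass tends to \<open>cdf gauss_dist 1 = 1\<close>, so normalising keeps the
  limit. Outside \<open>{0..1}\<close> both distribution functions are constant;
  \<open>Suc n\<close> avoids the degenerate period 0.\<close>

lemma per_mass_ratio_tendsto:
  "(\<lambda>n. per_mass (Suc n) t / per_mass (Suc n) 1) \<longlonglongrightarrow> cdf gauss_dist t"
proof -
  have lim: "(\<lambda>n. per_mass (Suc n) s) \<longlonglongrightarrow> cdf gauss_dist s" if "s \<in> {0..1}" for s
    using per_mass_tendsto[OF that] by (rule LIMSEQ_Suc)
  have ratio: "(\<lambda>n. per_mass (Suc n) s / per_mass (Suc n) 1) \<longlonglongrightarrow> cdf gauss_dist s"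
    if "s \<in> {0..1}" for s
    using tendsto_divide[OF lim[OF that] lim[of 1]] by (simp add: cdf_gauss_dist_1)
  consider "t < 0" | "t \<in> {0..1}" | "1 < t" by (cases "t < 0"; cases "1 < t") auto
  then show ?thesis
  proof cases
    case 1
    then have "cdf gauss_dist t = 0"
      using gauss_dist.cdf_nondecreasing[of t 0] gauss_dist.cdf_nonneg[of t] cdf_gauss_dist_0 by simp
    then show ?thesis using 1 by (simp add: per_mass_nonpos)
  next
    case 2
    then show ?thesis by (rule ratio)
  next
    case 3
    then have "cdf gauss_dist t = cdf gauss_dist 1"
      using gauss_dist.cdf_nondecreasing[of 1 t] gauss_dist.cdf_bounded_prob[of t] cdf_gauss_dist_1
      by simp
    then show ?thesis using 3 ratio[of 1] by (simp add: per_mass_ge_1[of _ t])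
  qed
qed

section \<open>Weak convergence\<close>

lemma nn_integral_count_space_conv_infsum:
  fixes f :: "'a \<Rightarrow> real"
  assumes "f summable_on A" "\<And>x. x \<in> A \<Longrightarrow> 0 \<le> f x"
  shows "(\<integral>\<^sup>+x. ennreal (f x) \<partial>count_space A) = ennreal (infsum f A)"
proof -
  have "(\<lambda>x. norm (f x)) summable_on A"
    using assms by (subst summable_on_cong[where g = f]) auto
  then have "Infinite_Set_Sum.abs_summable_on f A"
    by (simp only: abs_summable_equivalent)
  then show ?thesis
    by (subst nn_integral_conv_infsetsum) (simp_all add: assms(2) infsetsum_infsum)
qed

lemma per_mass_1_pos:
  assumes "0 < n"
  shows "0 < per_mass n 1"
proof -
  \<comment> \<open>All continued fraction digits equal to 1; one word of positive weight is
    enough.\<close>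
  let ?a = "replicate n 0"
  have ne: "?a \<noteq> []" using assms by simp
  let ?f = "\<lambda>a. point_weight a * indicator {..1} (periodic_point a)"
  have "?f ?a \<le> per_mass n 1"
  proof (rule has_sum_mono2[OF _ per_mass_has_sum[OF assms]])
    have "(g has_sum g ?a) {?a}" for g :: "nat list \<Rightarrow> real"
      using has_sum_finite[of "{?a}" g] by simp
    then show "(?f has_sum ?f ?a) {?a}" .
    fix a :: "nat list" assume "a \<in> {a. length a = n} - {?a}"
    then have "0 < point_weight a" using assms by (intro point_weight_pos) auto
    then show "0 \<le> ?f a" by simp
  qed simp
  moreover have "?f ?a = point_weight ?a"
    using irr01_bounds(2)[OF periodic_point(1)[OF ne]] by simp
  ultimately show ?thesis using point_weight_pos[OF ne] by simp
qed

lemma Per_nonempty: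
  assumes "0 < n"
  shows "Per n \<noteq> {}"
proof -
  have "periodic_point (replicate n 0) \<in> Per n"
    using bij_betw_periodic_point[OF assms] by (rule bij_betw_apply) simp
  then show ?thesis by blast
qed

lemma nn_integral_per_weight_atMost:
  assumes "0 < n"
  shows "(\<integral>\<^sup>+x. ennreal (per_weight n x) * indicator {..t} x \<partial>count_space (Per n)) =
    ennreal (per_mass n t)"
proof -
  let ?S = "{a :: nat list. length a = n}"
  have "(\<integral>\<^sup>+x. ennreal (per_weight n x) * indicator {..t} x \<partial>count_space (Per n)) =
      (\<integral>\<^sup>+a. ennreal (per_weight n (periodic_point a)) * indicator {..t} (periodic_point a)
        \<partial>count_space ?S)"
    by (rule nn_integral_bij_count_space[OF bij_betw_periodic_point[OF assms], symmetric])
  also have "\<dots> = (\<integral>\<^sup>+a. ennreal (point_weight a * indicator {..t} (periodic_point a))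
        \<partial>count_space ?S)"
    using assms
    by (intro nn_integral_cong)
       (auto simp: per_weight_periodic_point point_weight_def split: split_indicator)
  also have "\<dots> = ennreal (per_mass n t)"
    unfolding per_mass_def
  proof (rule nn_integral_count_space_conv_infsum)
    show "(\<lambda>a. point_weight a * indicator {..t} (periodic_point a)) summable_on ?S"
      using per_mass_has_sum[OF assms] by (rule has_sum_imp_summable)
    fix a assume "a \<in> ?S"
    then have "0 < point_weight a" using assms by (intro point_weight_pos) auto
    then show "0 \<le> point_weight a * indicator {..t} (periodic_point a)" by simp
  qed
  finally show ?thesis .
qed

lemma nn_integral_per_weight:
  assumes "0 < n"
  shows "(\<integral>\<^sup>+x. ennreal (per_weight n x) \<partial>count_space (Per n)) = ennreal (per_mass n 1)"
proof -
  have "(\<integral>\<^sup>+x. ennreal (per_weight n x) \<partial>count_space (Per n)) =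
      (\<integral>\<^sup>+x. ennreal (per_weight n x) * indicator {..1} x \<partial>count_space (Per n))"
    by (intro nn_integral_cong) (auto simp: Per_def irr01_def split: split_indicator)
  then show ?thesis using nn_integral_per_weight_atMost[OF assms] by simp
qed

text \<open>The Gauss map permutes \<open>Per n\<close> and preserves the weights, so each shift is
  a change of variables.\<close>

lemma nn_integral_per_weight_shift:
  assumes "0 < n"
  shows "(\<integral>\<^sup>+x. ennreal (per_weight n x) * indicator A ((gauss_map ^^ i) x) \<partial>count_space (Per n)) =
    (\<integral>\<^sup>+x. ennreal (per_weight n x) * indicator A x \<partial>count_space (Per n))"
proof (induction i)
  case (Suc i)
  let ?g = "\<lambda>x. ennreal (per_weight n x) * indicator A ((gauss_map ^^ i) x)"
  have "(\<integral>\<^sup>+x. ennreal (per_weight n x) * indicator A ((gauss_map ^^ Suc i) x) \<partial>count_space (Per n))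
      = (\<integral>\<^sup>+x. ?g (gauss_map x) \<partial>count_space (Per n))"
    by (intro nn_integral_cong) (simp add: per_weight_gauss_map funpow_swap1)
  also have "\<dots> = (\<integral>\<^sup>+x. ?g x \<partial>count_space (Per n))"
    by (rule nn_integral_bij_count_space[OF bij_betw_gauss_map_Per[OF assms]])
  finally show ?case using Suc.IH by simp
qed simp

text \<open>Since the weights are invariant under the Gauss map, averaging along orbits has no effect.\<close>

lemma emeasure_periodic_measure_eq:
  assumes "A \<in> sets borel_irr" "0 < n"
  shows "emeasure (periodic_measure n) A = inverse (ennreal (per_mass n 1)) *
    (\<integral>\<^sup>+x. ennreal (per_weight n x) * indicator A x \<partial>count_space (Per n))"
proof -
  let ?I = "\<integral>\<^sup>+x. ennreal (per_weight n x) * indicator A x \<partial>count_space (Per n)"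
  have "(\<integral>\<^sup>+x. ennreal (per_weight n x) * emeasure (orbit_measure n x) A \<partial>count_space (Per n)) =
      (\<integral>\<^sup>+x. ennreal (1 / real n) *
        (\<Sum>i<n. ennreal (per_weight n x) * indicator A ((gauss_map ^^ i) x)) \<partial>count_space (Per n))"
  proof (intro nn_integral_cong)
    fix x assume "x \<in> space (count_space (Per n))"
    then have x: "x \<in> irr01" by (simp add: Per_def)
    have "emeasure (orbit_measure n x) A =
        ennreal (1 / real n * (\<Sum>i<n. indicator A ((gauss_map ^^ i) x)))"
      using assms x by (intro emeasure_orbit_measure) auto
    also have "\<dots> = ennreal (1 / real n) * ennreal (\<Sum>i<n. indicator A ((gauss_map ^^ i) x))"
      by (intro ennreal_mult sum_nonneg) auto
    also have "ennreal (\<Sum>i<n. indicator A ((gauss_map ^^ i) x)) =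
        (\<Sum>i<n. indicator A ((gauss_map ^^ i) x))"
      by (subst sum_ennreal[symmetric]) (auto simp: ennreal_indicator)
    finally have "emeasure (orbit_measure n x) A =
        ennreal (1 / real n) * (\<Sum>i<n. indicator A ((gauss_map ^^ i) x))" .
    then show "ennreal (per_weight n x) * emeasure (orbit_measure n x) A = ennreal (1 / real n) *
        (\<Sum>i<n. ennreal (per_weight n x) * indicator A ((gauss_map ^^ i) x))"
      by (simp add: sum_distrib_left mult_ac)
  qed
  also have "\<dots> = ennreal (1 / real n) * (\<Sum>i<n. ?I)"
    by (subst nn_integral_cmult, simp, subst nn_integral_sum, simp)
       (simp only: nn_integral_per_weight_shift[OF assms(2)])
  also have "\<dots> = ennreal (1 / real n) * ennreal (real n) * ?I"
    by (simp add: mult.assoc ennreal_of_nat_eq_real_of_nat)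
  also have "ennreal (1 / real n) * ennreal (real n) = 1"
    using assms(2) by (simp flip: ennreal_mult)
  finally show ?thesis
    using emeasure_periodic_measure[OF assms(1) _ Per_nonempty[OF assms(2)]] assms(2)
    by (simp add: nn_integral_per_weight)
qed

section \<open>Image measures on the real line and their distribution functions\<close>

lemma sets_periodic_measure:
  assumes "0 < n"
  shows "sets (periodic_measure n) = sets borel_irr"
proof -
  have "sets (density (count_space (Per n)) (\<lambda>x. ennreal (per_weight n x)) \<bind> orbit_measure n) =
      sets borel_irr"
    using Per_nonempty[OF assms] by (intro sets_bind) (auto simp: orbit_measure_def)
  then show ?thesis by (simp add: periodic_measure_def)
qed

lemma measurable_ident_periodic_measure:
  assumes "0 < n"
  shows "(\<lambda>x. x) \<in> periodic_measure n \<rightarrow>\<^sub>M borel"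
  by (subst measurable_cong_sets[OF sets_periodic_measure[OF assms] refl])
     (simp add: borel_irr_def measurable_restrict_space1)

lemma emeasure_distr_periodic_measure:
  assumes "0 < n"
  shows "emeasure (distr (periodic_measure n) borel (\<lambda>x. x)) {..t} =
    ennreal (per_mass n t / per_mass n 1)"
proof -
  have sp: "space (periodic_measure n) = irr01"
    using sets_eq_imp_space_eq[OF sets_periodic_measure[OF assms]] by simp
  have meas: "{..t} \<inter> irr01 \<in> sets borel_irr"
    by (auto simp: borel_irr_def sets_restrict_space)
  have "emeasure (distr (periodic_measure n) borel (\<lambda>x. x)) {..t} =
      emeasure (periodic_measure n) ({..t} \<inter> irr01)"
    using measurable_ident_periodic_measure[OF assms] by (subst emeasure_distr) (auto simp: sp)
  also have "\<dots> = inverse (ennreal (per_mass n 1)) *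
      (\<integral>\<^sup>+x. ennreal (per_weight n x) * indicator ({..t} \<inter> irr01) x \<partial>count_space (Per n))"
    by (rule emeasure_periodic_measure_eq[OF meas assms])
  also have "(\<integral>\<^sup>+x. ennreal (per_weight n x) * indicator ({..t} \<inter> irr01) x \<partial>count_space (Per n)) =
      (\<integral>\<^sup>+x. ennreal (per_weight n x) * indicator {..t} x \<partial>count_space (Per n))"
    by (intro nn_integral_cong) (auto simp: Per_def split: split_indicator)
  also have "\<dots> = ennreal (per_mass n t)"
    by (rule nn_integral_per_weight_atMost[OF assms])
  also have "inverse (ennreal (per_mass n 1)) * \<dots> = ennreal (per_mass n t / per_mass n 1)"
    using per_mass_nonneg[OF assms] per_mass_1_pos[OF assms]
      divide_ennreal[of "per_mass n t" "per_mass n 1"]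
    by (simp add: divide_ennreal_def mult.commute)
  finally show ?thesis .
qed

lemma real_distribution_periodic_measure:
  assumes "0 < n"
  shows "real_distribution (distr (periodic_measure n) borel (\<lambda>x. x))"
proof (intro real_distribution.intro real_distribution_axioms.intro prob_spaceI)
  let ?M = "distr (periodic_measure n) borel (\<lambda>x. x)"
  have sp: "space (periodic_measure n) = irr01"
    using sets_eq_imp_space_eq[OF sets_periodic_measure[OF assms]] by simp
  have "emeasure ?M {..1} = 1"
    using emeasure_distr_periodic_measure[OF assms, of 1] per_mass_1_pos[OF assms] by simp
  moreover have "emeasure ?M UNIV = emeasure ?M {..1}"
    using measurable_ident_periodic_measure[OF assms]
    by (simp add: emeasure_distr sp)
       (auto intro!: arg_cong[where f = "emeasure _"] simp: irr01_def)
  ultimately show "emeasure ?M (space ?M) = 1" by simp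
qed simp

lemma cdf_periodic_measure:
  assumes "0 < n"
  shows "cdf (distr (periodic_measure n) borel (\<lambda>x. x)) t = per_mass n t / per_mass n 1"
proof -
  interpret real_distribution "distr (periodic_measure n) borel (\<lambda>x. x)"
    by (rule real_distribution_periodic_measure[OF assms])
  show ?thesis
    using emeasure_distr_periodic_measure[OF assms, of t] per_mass_1_pos[OF assms]
      per_mass_nonneg[OF assms]
    unfolding cdf_def emeasure_eq_measure by simp
qed

lemma AE_irr01: "AE x in lborel. x \<in> {0..1} \<longrightarrow> x \<in> irr01"
proof -
  have "\<rat> \<in> null_sets (lborel :: real measure)"
    by (intro countable_imp_null_set_lborel countable_rat)
  then have "AE x in lborel. x \<notin> (\<rat> :: real set)" by (rule AE_not_in)
  then show ?thesis
  proof eventually_elim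
    case (elim x)
    then have "x \<noteq> 0" "x \<noteq> 1" by auto
    then show ?case using elim by (auto simp: irr01_def)
  qed
qed

text \<open>The image under the inclusion into the line; the set of rationals that separates the two
  measures is null.\<close>

lemma distr_gauss_measure:
  "(\<lambda>x. x) \<in> gauss_measure \<rightarrow>\<^sub>M borel" "distr gauss_measure borel (\<lambda>x. x) = gauss_dist"
proof -
  show meas: "(\<lambda>x. x) \<in> gauss_measure \<rightarrow>\<^sub>M borel"
    unfolding gauss_measure_def by (simp add: measurable_restrict_space1)
  show "distr gauss_measure borel (\<lambda>x. x) = gauss_dist"
  proof (rule measure_eqI)
    fix A assume "A \<in> sets (distr gauss_measure borel (\<lambda>x. x))"
    then have A [measurable]: "A \<in> sets borel" by simp
    have sp: "space gauss_measure = irr01"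
      by (simp add: gauss_measure_def space_restrict_space)
    have Ai: "A \<inter> irr01 \<in> sets (restrict_space lborel irr01)"
      by (auto simp: sets_restrict_space)
    have "emeasure (distr gauss_measure borel (\<lambda>x. x)) A = emeasure gauss_measure (A \<inter> irr01)"
      using meas by (subst emeasure_distr) (auto simp: sp)
    also have "\<dots> = (\<integral>\<^sup>+x. ennreal (1 / (ln 2 * (1 + x))) * indicator (A \<inter> irr01) x
        \<partial>restrict_space lborel irr01)"
      unfolding gauss_measure_def
      by (rule emeasure_density[OF _ Ai]) (auto intro!: measurable_restrict_space1)
    also have "\<dots> = (\<integral>\<^sup>+x. ennreal (1 / (ln 2 * (1 + x))) * indicator (A \<inter> irr01) x * indicator irr01 x
        \<partial>lborel)"
      by (subst nn_integral_restrict_space) auto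
    also have "\<dots> = (\<integral>\<^sup>+x. ennreal (gauss_density x) * indicator A x \<partial>lborel)"
    proof (rule nn_integral_cong_AE)
      show "AE x in lborel. ennreal (1 / (ln 2 * (1 + x))) * indicator (A \<inter> irr01) x * indicator irr01 x
          = ennreal (gauss_density x) * indicator A x"
        using AE_irr01
      proof eventually_elim
        case (elim x)
        then show ?case
          using irr01_bounds(3)[of x]
          by (cases "x \<in> irr01") (auto simp: gauss_density_def indicator_def)
      qed
    qed
    also have "\<dots> = emeasure gauss_dist A"
      unfolding gauss_dist_def by (rule emeasure_density[symmetric]) auto
    finally show "emeasure (distr gauss_measure borel (\<lambda>x. x)) A = emeasure gauss_dist A" .
  qed simp
qed

theorem proposition1p4:
  shows "weak_star_converges irr01 periodic_measure gauss_measure"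
  unfolding weak_star_converges_def
proof (intro allI impI)
  fix f :: "real \<Rightarrow> real"
  assume f: "continuous_on irr01 f \<and> bounded (f ` irr01)"
  \<comment> \<open>Off the irrationals \<open>f\<close> is uncontrolled. Its extension by 0 is
    Borel and agrees with \<open>f\<close> almost everywhere for all the measures involved.\<close>
  define g where "g x = (if x \<in> irr01 then f x else 0)" for x
  obtain B where B: "\<And>x. x \<in> irr01 \<Longrightarrow> \<bar>f x\<bar> \<le> B"
    using f by (auto simp: bounded_iff)
  have "f \<in> borel_measurable (restrict_space borel irr01)"
    using f by (intro borel_measurable_continuous_on_restrict) auto
  then have g_meas [measurable]: "g \<in> borel_measurable borel"
    unfolding g_def by (subst (asm) measurable_restrict_space_iff[where c = 0]) auto
  \<comment> \<open>Started at period 1, so that every term is a probability distribution; the shift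
    is undone at the end.\<close>
  define \<mu> where "\<mu> n = distr (periodic_measure (Suc n)) borel (\<lambda>x. x)" for n
  have int_\<mu>: "(\<integral>x. f x \<partial>periodic_measure (Suc n)) = (\<integral>x. g x \<partial>\<mu> n)" for n
  proof -
    have "space (periodic_measure (Suc n)) = irr01"
      using sets_eq_imp_space_eq[OF sets_periodic_measure, of "Suc n"] by simp
    then show ?thesis
      unfolding \<mu>_def using measurable_ident_periodic_measure[of "Suc n"]
      by (subst integral_distr) (auto intro!: Bochner_Integration.integral_cong simp: g_def)
  qed
  have int_gauss: "(\<integral>x. f x \<partial>gauss_measure) = (\<integral>x. g x \<partial>gauss_dist)"
    unfolding distr_gauss_measure(2)[symmetric] using distr_gauss_measure(1)
    by (subst integral_distr)
       (auto intro!: Bochner_Integration.integral_cong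
         simp: g_def gauss_measure_def space_restrict_space)
  have conv: "weak_conv_m \<mu> gauss_dist"
    unfolding weak_conv_m_def weak_conv_def \<mu>_def
    using per_mass_ratio_tendsto by (simp add: cdf_periodic_measure)
  have "real_distribution (\<mu> n)" for n
    unfolding \<mu>_def by (rule real_distribution_periodic_measure) simp
  from Skorohod[OF this gauss_dist.real_distribution_axioms conv]
  obtain \<Omega> :: "real measure" and Y_seq Y where
    \<Omega>: "prob_space \<Omega>" and
    Y_seq [measurable]: "\<And>n. Y_seq n \<in> borel_measurable \<Omega>" and
    distr_Y_seq: "\<And>n. distr \<Omega> borel (Y_seq n) = \<mu> n" and
    Y [measurable]: "Y \<in> borel_measurable \<Omega>" and
    distr_Y: "distr \<Omega> borel Y = gauss_dist" and
    lim: "\<And>x. x \<in> space \<Omega> \<Longrightarrow> (\<lambda>n. Y_seq n x) \<longlonglongrightarrow> Y x"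
    by force
  interpret prob_space \<Omega> by (rule \<Omega>)
  have AE_Y: "AE x in \<Omega>. Y x \<in> irr01"
  proof -
    have "AE x in gauss_dist. x \<in> irr01"
      unfolding distr_gauss_measure(2)[symmetric] using distr_gauss_measure(1)
      by (subst AE_distr_iff)
         (auto intro!: AE_I2 simp: gauss_measure_def space_restrict_space)
    then show ?thesis unfolding distr_Y[symmetric] by (subst (asm) AE_distr_iff) auto
  qed
  have AE_Y_seq: "AE x in \<Omega>. Y_seq n x \<in> irr01" for n
  proof -
    have "space (periodic_measure (Suc n)) = irr01"
      using sets_eq_imp_space_eq[OF sets_periodic_measure, of "Suc n"] by simp
    then have "AE x in \<mu> n. x \<in> irr01"
      unfolding \<mu>_def using measurable_ident_periodic_measure[of "Suc n"]
      by (subst AE_distr_iff) (auto intro!: AE_I2)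
    then show ?thesis unfolding distr_Y_seq[symmetric] by (subst (asm) AE_distr_iff) auto
  qed
  have "(\<lambda>n. \<integral>x. g (Y_seq n x) \<partial>\<Omega>) \<longlonglongrightarrow> (\<integral>x. g (Y x) \<partial>\<Omega>)"
  proof (rule integral_dominated_convergence[where w = "\<lambda>_. \<bar>B\<bar>"])
    \<comment> \<open>On almost every sample all the \<open>Y_seq n x\<close> and the limit
      \<open>Y x\<close> are irrational, so continuity of \<open>f\<close> on the irrationals
      suffices along the sequence.\<close>
    have "AE x in \<Omega>. \<forall>n. Y_seq n x \<in> irr01" using AE_Y_seq by (simp add: AE_all_countable)
    then show "AE x in \<Omega>. (\<lambda>n. g (Y_seq n x)) \<longlonglongrightarrow> g (Y x)"
      using AE_Y AE_space
    proof eventually_elim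
      case (elim x)
      have "(\<lambda>n. f (Y_seq n x)) \<longlonglongrightarrow> f (Y x)"
        using f elim by (intro continuous_on_tendsto_compose[OF _ lim]) auto
      then show ?case using elim by (simp add: g_def)
    qed
    show "AE x in \<Omega>. norm (g (Y_seq n x)) \<le> \<bar>B\<bar>" for n
      using B by (intro AE_I2) (force simp: g_def)
  qed auto
  also have "(\<integral>x. g (Y x) \<partial>\<Omega>) = (\<integral>x. g x \<partial>gauss_dist)"
    unfolding distr_Y[symmetric] by (rule integral_distr[symmetric]) auto
  also have "(\<lambda>n. \<integral>x. g (Y_seq n x) \<partial>\<Omega>) = (\<lambda>n. \<integral>x. g x \<partial>\<mu> n)"
    unfolding distr_Y_seq[symmetric] by (intro ext integral_distr[symmetric]) auto
  finally have "(\<lambda>n. \<integral>x. f x \<partial>periodic_measure (Suc n)) \<longlonglongrightarrow> (\<integral>x. f x \<partial>gauss_measure)"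
    unfolding int_\<mu> int_gauss .
  then show "(\<lambda>n. \<integral>x. f x \<partial>periodic_measure n) \<longlonglongrightarrow> (\<integral>x. f x \<partial>gauss_measure)"
    by (rule LIMSEQ_imp_Suc)
qed

end
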